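(* Let $d\ge 3$, $P\ge1$, $K\ge 1$ be integers, let $F\in C([0,1])$, $a=(a_0,\dots,a_{K-1})\in\mathbb{R}^K$ and $f_a=\sum_{k=0}^{K-1}a_kg_k$. Moreover, let $w\in L^1([0,1],1/s)$ be a positive weight and $C_w=\|w\|_{L^1([0,1],1/s)}=\int_0^1\frac{w(s)}{s}\,\mathrm{d}s<\infty$. Then $$\|\mathcal E_{d,P}[f_a,F]\|_{L^2([0,1],w)}^2\le c_dC_wP^{-1}\|f_a\|_{L^2([0,1])}^2+\|F-\mathcal S_d[f_a]\|_{L^2([0,1],w)}^2$$ and $$\|\mathcal E_{d,P}[f_a,F]\|_{L^\infty([0,1])}^2\le 3P^{-1}\|f_a\|_{H^1([0,1])}^2+2\|F-\mathcal S_d[f_a]\|_{H^1([0,1])}^2,$$ where the right-hand side of the second inequality is understood as $+\infty$ if $F\notin H^1([0,1])$.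
   Context: For an integer $d\ge 3$ let $\varrho_d(t)=c_d(1-t^2)^{\frac{d-3}{2}}$ with $c_d=\frac{2\Gamma(d/2)}{\sqrt{\pi}\,\Gamma((d-1)/2)}$, and define the slicing operator $\mathcal S_d[f](s)=\int_0^1 f(ts)\varrho_d(t)\,\mathrm{d}t$, $s\in[0,1]$. The cosine system is $g_0(t)=1$ and $g_k(t)=\sqrt2\cos(\pi kt)$ for $k\ge1$. For $f,F\in C([0,1])$ the mean square error is the function on $[0,1]$ given, for $s\in[0,1]$ and any $x\in\mathbb{R}^d$ with $\|x\|=s$, by $$\mathcal E_{d,P}[f,F](s)^2=\mathbb E_{\xi_1,\dots,\xi_P}\Bigl[\Bigl(\frac1P\sum_{p=1}^P f(|\langle\xi_p,x\rangle|)-F(\|x\|)\Bigr)^2\Bigr],\qquad \mathcal E_{d,P}[f,F](s)\ge0,$$ where $\xi_1,\dots,\xi_P$ are independent and uniformly distributed on the unit sphere $\mathbb S^{d-1}$ (this depends only on $s$). Norms: $\|f\|_{L^p([0,1],w)}^p=\int_0^1|f(s)|^pw(s)\,\mathrm{d}s$, $L^p([0,1],1/s)$ is the case $w(s)=1/s$, and $\|f\|_{H^1([0,1])}^2=\|f\|_{L^2([0,1])}^2+\|f'\|_{L^2([0,1])}^2$. *)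

theory Defs
  imports "HOL-Probability.Probability"
begin

section \<open>The uniform distribution on the unit sphere\<close>

text \<open>
  The normalised surface measure is obtained by projecting the uniform distribution on the unit
  ball radially onto the sphere (\<open>sgn x = x /\<^sub>R norm x\<close>). The lemmas of this section show that this is
  a rotation invariant probability measure on Borel sets that is concentrated on the sphere.
\<close>

definition uniform_sphere :: "'a::euclidean_space measure" where
  "uniform_sphere = distr (uniform_measure lborel (ball 0 1)) borel sgn"

lemma emeasure_ball01:
  "emeasure lborel (ball (0::'a::euclidean_space) 1) \<noteq> 0"
  "emeasure lborel (ball (0::'a::euclidean_space) 1) \<noteq> \<infinity>"
proof -
  show "emeasure lborel (ball (0::'a) 1) \<noteq> \<infinity>"
    using emeasure_bounded_finite[of "ball (0::'a) 1"] by auto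
  have "emeasure lebesgue (ball (0::'a) 1) \<noteq> 0"
    using open_not_negligible[of "ball (0::'a) 1"] by (simp add: negligible_iff_emeasure0)
  then show "emeasure lborel (ball (0::'a) 1) \<noteq> 0"
    by simp
qed

lemma borel_measurable_sgn_euclidean [measurable]:
  "(sgn :: 'a::euclidean_space \<Rightarrow> 'a) \<in> borel_measurable borel"
  unfolding sgn_div_norm[abs_def] by measurable

lemma sets_uniform_sphere [simp, measurable_cong]: "sets uniform_sphere = sets borel"
  and space_uniform_sphere [simp]: "space uniform_sphere = UNIV"
  by (simp_all add: uniform_sphere_def)

lemma prob_space_uniform_sphere: "prob_space (uniform_sphere :: 'a::euclidean_space measure)"
proof -
  interpret prob_space "uniform_measure lborel (ball (0::'a) 1)"
    using emeasure_ball01 by (rule prob_space_uniform_measure)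
  show ?thesis
    unfolding uniform_sphere_def by (rule prob_space_distr) measurable
qed

lemma AE_uniform_sphere: "AE x in (uniform_sphere :: 'a::euclidean_space measure). norm x = 1"
proof -
  have "AE x in lborel. x \<noteq> (0::'a)"
    by (rule AE_lborel_singleton)
  then have "AE x in uniform_measure lborel (ball (0::'a) 1). norm (sgn x) = 1"
    by (intro AE_uniform_measureI) (auto simp: norm_sgn)
  then show ?thesis
    unfolding uniform_sphere_def by (subst AE_distr_iff) auto
qed

lemma lborel_distr_orthogonal_transformation:
  fixes T :: "'a::euclidean_space \<Rightarrow> 'a"
  assumes T: "orthogonal_transformation T"
  shows "distr lborel borel T = lborel"
proof (rule measure_eqI)
  have lin: "linear T" using T by (simp add: orthogonal_transformation_linear)
  have Tm [measurable]: "T \<in> borel_measurable borel"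
    using lin by (intro borel_measurable_continuous_onI linear_continuous_on)
                 (simp add: linear_conv_bounded_linear)
  let ?M = "distr lborel borel T"
  define B where "B = ball (0::'a) 1"
  have B [measurable]: "B \<in> sets borel" by (simp add: B_def)
  fix A :: "'a set" assume "A \<in> sets ?M"
  then have A [measurable]: "A \<in> sets borel" by simp
  have vim: "T -` B = B"
    using T by (auto simp: B_def orthogonal_transformation_norm)
  have MB: "emeasure ?M B = emeasure lborel B"
    by (subst emeasure_distr) (simp_all add: vim)
  have lborel_shift: "(\<integral>\<^sup>+y. f (x + y) \<partial>lborel) = (\<integral>\<^sup>+y. f y \<partial>lborel)"
    if [measurable]: "f \<in> borel_measurable borel" for f :: "'a \<Rightarrow> ennreal" and x
    using nn_integral_distr[of "(+) x" lborel borel f] by (simp add: lborel_distr_plus)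
  have surj: "surj T" using T by (rule orthogonal_transformation_surj)
  have shift: "(\<integral>\<^sup>+x. f (x + y) \<partial>?M) = (\<integral>\<^sup>+x. f x \<partial>?M)"
    if [measurable]: "f \<in> borel_measurable borel" for f :: "'a \<Rightarrow> ennreal" and y
  proof -
    obtain z where z: "y = T z" using surj by (metis surjD)
    have "(\<integral>\<^sup>+x. f (x + y) \<partial>?M) = (\<integral>\<^sup>+x. f (T (z + x)) \<partial>lborel)"
      by (subst nn_integral_distr) (simp_all add: z linear_add[OF lin] add.commute)
    also have "\<dots> = (\<integral>\<^sup>+x. f (T x) \<partial>distr lborel borel ((+) z))"
      by (subst nn_integral_distr) simp_all
    also have "\<dots> = (\<integral>\<^sup>+x. f x \<partial>?M)"
      by (simp add: lborel_distr_plus nn_integral_distr)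
    finally show ?thesis .
  qed
  interpret M: sigma_finite_measure ?M
  proof (standard, intro exI[of _ "range (\<lambda>n::nat. ball (0::'a) n)"] conjI ballI)
    show "\<Union>(range (\<lambda>n::nat. ball (0::'a) n)) = space ?M"
      by (auto simp: reals_Archimedean2)
    fix a assume "a \<in> range (\<lambda>n::nat. ball (0::'a) n)"
    then obtain n :: nat where a: "a = ball 0 (real n)" by auto
    have "T -` a = a" unfolding a using T by (auto simp: orthogonal_transformation_norm)
    then have "emeasure ?M a = emeasure lborel a"
      by (subst emeasure_distr) (simp_all add: a)
    then show "emeasure ?M a \<noteq> \<infinity>"
      using emeasure_bounded_finite[of a] a by auto
  qed auto
  interpret P: pair_sigma_finite ?M "lborel :: 'a measure"
    by unfold_locales
  have "emeasure ?M A * emeasure lborel B = (\<integral>\<^sup>+x. indicator A x * emeasure lborel B \<partial>?M)"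
    by (subst nn_integral_multc) simp_all
  also have "\<dots> = (\<integral>\<^sup>+x. (\<integral>\<^sup>+y. indicator A x * indicator B y \<partial>lborel) \<partial>?M)"
    by (intro nn_integral_cong) (simp add: nn_integral_cmult_indicator)
  also have "\<dots> = (\<integral>\<^sup>+x. (\<integral>\<^sup>+y. indicator A x * indicator B (y - x) \<partial>lborel) \<partial>?M)"
  proof (rule nn_integral_cong)
    fix x :: 'a
    show "(\<integral>\<^sup>+y. indicator A x * indicator B y \<partial>lborel)
        = (\<integral>\<^sup>+y. (indicator A x * indicator B (y - x) :: ennreal) \<partial>lborel)"
      by (subst lborel_shift[of "\<lambda>y. indicator A x * indicator B (y - x)" x, symmetric]) simp_all
  qed
  also have "\<dots> = (\<integral>\<^sup>+y. (\<integral>\<^sup>+x. indicator A x * indicator B (y - x) \<partial>?M) \<partial>lborel)"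
    by (rule P.Fubini'[symmetric]) (unfold split_beta', measurable)
  also have "\<dots> = (\<integral>\<^sup>+y. (\<integral>\<^sup>+x. indicator A (x + y) * indicator B (- x) \<partial>?M) \<partial>lborel)"
  proof (rule nn_integral_cong)
    fix y :: 'a
    show "(\<integral>\<^sup>+x. indicator A x * indicator B (y - x) \<partial>?M)
        = (\<integral>\<^sup>+x. (indicator A (x + y) * indicator B (- x) :: ennreal) \<partial>?M)"
      by (subst shift[of "\<lambda>x. indicator A x * indicator B (y - x)" y, symmetric]) simp_all
  qed
  also have "\<dots> = (\<integral>\<^sup>+x. (\<integral>\<^sup>+y. indicator A (x + y) * indicator B (- x) \<partial>lborel) \<partial>?M)"
    by (rule P.Fubini') (unfold split_beta', measurable)
  also have "\<dots> = (\<integral>\<^sup>+x. emeasure lborel A * indicator B x \<partial>?M)"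
  proof (rule nn_integral_cong)
    fix x :: 'a
    have "(\<integral>\<^sup>+y. indicator A (x + y) \<partial>lborel) = emeasure lborel A"
      by (subst lborel_shift) simp_all
    moreover have "indicator B (- x) = (indicator B x :: ennreal)"
      by (auto simp: indicator_def B_def)
    ultimately show "(\<integral>\<^sup>+y. indicator A (x + y) * indicator B (- x) \<partial>lborel)
        = emeasure lborel A * indicator B x"
      by (subst nn_integral_multc) simp_all
  qed
  also have "\<dots> = emeasure lborel A * emeasure lborel B"
    by (simp add: nn_integral_cmult MB)
  finally have "emeasure ?M A * emeasure lborel B = emeasure lborel A * emeasure lborel B" .
  then show "emeasure ?M A = emeasure lborel A"
    using emeasure_ball01[where 'a = 'a] ennreal_mult_divide_eq[of "emeasure lborel B"]
    unfolding B_def by (metis infinity_ennreal_def)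
qed simp

lemma uniform_sphere_rotation_invariant:
  fixes T :: "'a::euclidean_space \<Rightarrow> 'a"
  assumes T: "orthogonal_transformation T"
  shows "distr uniform_sphere borel T = uniform_sphere"
proof (rule measure_eqI)
  have lin: "linear T" using T by (simp add: orthogonal_transformation_linear)
  have Tm [measurable]: "T \<in> borel_measurable borel"
    using lin by (intro borel_measurable_continuous_onI linear_continuous_on)
                 (simp add: linear_conv_bounded_linear)
  fix A :: "'a set" assume "A \<in> sets (distr uniform_sphere borel T)"
  then have A [measurable]: "A \<in> sets borel" by simp
  have [measurable]: "sgn -` C \<in> sets borel" if "C \<in> sets borel" for C :: "'a set"
    using measurable_sets[OF borel_measurable_sgn_euclidean that] by simp
  have TA [measurable]: "T -` A \<in> sets borel"
    using measurable_sets[OF Tm A] by simp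
  have us: "emeasure uniform_sphere C
      = emeasure lborel (ball 0 1 \<inter> sgn -` C) / emeasure lborel (ball (0::'a) 1)"
    if [measurable]: "C \<in> sets borel" for C :: "'a set"
  proof -
    have "emeasure uniform_sphere C = emeasure (uniform_measure lborel (ball (0::'a) 1)) (sgn -` C)"
      unfolding uniform_sphere_def
      by (subst emeasure_distr) (simp_all add: measurable_cong_sets[OF sets_uniform_measure refl])
    also have "\<dots> = emeasure lborel (ball 0 1 \<inter> sgn -` C) / emeasure lborel (ball (0::'a) 1)"
      by (rule emeasure_uniform_measure) simp_all
    finally show ?thesis .
  qed
  have sgnT: "sgn (T x) = T (sgn x)" for x
    using T lin by (simp add: sgn_div_norm orthogonal_transformation_norm linear_scale)
  have "emeasure (distr uniform_sphere borel T) A = emeasure uniform_sphere (T -` A)"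
    by (subst emeasure_distr) simp_all
  also have "\<dots> = emeasure lborel (T -` (ball 0 1 \<inter> sgn -` A)) / emeasure lborel (ball (0::'a) 1)"
    using T by (subst us) (auto simp: orthogonal_transformation_norm sgnT
        intro!: arg_cong2[where f = "(/)"] arg_cong[where f = "emeasure lborel"])
  also have "emeasure lborel (T -` (ball 0 1 \<inter> sgn -` A))
      = emeasure (distr lborel borel T) (ball 0 1 \<inter> sgn -` A)"
    by (subst emeasure_distr) simp_all
  also have "\<dots> / emeasure lborel (ball (0::'a) 1) = emeasure uniform_sphere A"
    by (subst us) (simp_all add: lborel_distr_orthogonal_transformation[OF T])
  finally show "emeasure (distr uniform_sphere borel T) A = emeasure uniform_sphere A" .
qed simp


section \<open>Slicing\<close>

definition slicing_const :: "nat \<Rightarrow> real" where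
  "slicing_const d = 2 * Gamma (real d / 2) / (sqrt pi * Gamma ((real d - 1) / 2))"

text \<open>
  For \<open>d \<ge> 3\<close> and \<open>\<bar>t\<bar> \<le> 1\<close> the last factor is \<open>(1 - t\<^sup>2)\<close> to the power \<open>(d - 3) / 2\<close>; the natural power
  of the square root also gives the value 1 at \<open>t = 1\<close>, \<open>d = 3\<close>, where \<open>powr\<close> would give 0.
\<close>

definition slicing_density :: "nat \<Rightarrow> real \<Rightarrow> real" where
  "slicing_density d t = slicing_const d * sqrt (1 - t\<^sup>2) ^ (d - 3)"

definition slicing_op :: "nat \<Rightarrow> (real \<Rightarrow> real) \<Rightarrow> real \<Rightarrow> real" where
  "slicing_op d f s = (LINT t|lebesgue_on {0..1}. f (t * s) * slicing_density d t)"

definition cos_system :: "nat \<Rightarrow> real \<Rightarrow> real" where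
  "cos_system k t = (if k = 0 then 1 else sqrt 2 * cos (pi * real k * t))"

definition cos_poly :: "nat \<Rightarrow> (nat \<Rightarrow> real) \<Rightarrow> real \<Rightarrow> real" where
  "cos_poly K a t = (\<Sum>k<K. a k * cos_system k t)"

text \<open>
  Root mean square error for random directions \<open>\<xi> 1, \<dots>, \<xi> P\<close> on a probability space \<open>M\<close>. For
  independent directions that are uniformly distributed on the sphere, the choice of the point of
  norm \<open>s\<close> is immaterial, see \<open>slicing_rmse_square\<close> below.
\<close>

definition slicing_rmse ::
  "'w measure \<Rightarrow> (nat \<Rightarrow> 'w \<Rightarrow> 'a::euclidean_space) \<Rightarrow> nat \<Rightarrow> (real \<Rightarrow> real) \<Rightarrow> (real \<Rightarrow> real) \<Rightarrow> real \<Rightarrow> real"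
  where
  "slicing_rmse M \<xi> P f F s =
     (let x = (SOME x. norm x = s) in
      sqrt (LINT \<omega>|M. ((1 / real P) * (\<Sum>p=1..P. f \<bar>\<xi> p \<omega> \<bullet> x\<bar>) - F (norm x))\<^sup>2))"

lemma slicing_rmse_square:
  fixes \<xi> :: "nat \<Rightarrow> 'w \<Rightarrow> real ^ 'n"
  assumes M: "prob_space M"
    and indep: "prob_space.indep_vars M (\<lambda>_. borel) \<xi> {1..P}"
    and unif: "\<And>p. p \<in> {1..P} \<Longrightarrow> distr M borel (\<xi> p) = uniform_sphere"
    and f: "f \<in> borel_measurable borel"
    and x: "norm x = s"
  shows "0 \<le> slicing_rmse M \<xi> P f F s"
    and "(slicing_rmse M \<xi> P f F s)\<^sup>2 =
      (LINT \<omega>|M. ((1 / real P) * (\<Sum>p=1..P. f \<bar>\<xi> p \<omega> \<bullet> x\<bar>) - F (norm x))\<^sup>2)"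
proof -
  interpret prob_space M by (rule M)
  define y :: "real ^ 'n" where "y = (SOME y. norm y = s)"
  have y: "norm y = s" unfolding y_def using x by (rule someI)
  obtain T where T: "orthogonal_transformation T" and Tx: "T x = y"
    using orthogonal_transformation_exists[of x y] x y by auto
  have Tm [measurable]: "T \<in> borel_measurable borel"
    using T by (intro borel_measurable_continuous_onI linear_continuous_on)
      (simp add: linear_conv_bounded_linear[symmetric] orthogonal_transformation_linear)
  define H :: "(nat \<Rightarrow> real ^ 'n) \<Rightarrow> real"
    where "H = (\<lambda>v. ((1 / real P) * (\<Sum>p=1..P. f \<bar>v p \<bullet> y\<bar>) - F (norm y))\<^sup>2)"
  note f [measurable]
  have Hm [measurable]: "H \<in> borel_measurable (\<Pi>\<^sub>M p\<in>{1..P}. borel)"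
    unfolding H_def by measurable
  have rv [measurable]: "\<And>p. p \<in> {1..P} \<Longrightarrow> random_variable borel (\<xi> p)"
    using indep by (auto simp: indep_vars_def)
  have "(LINT \<omega>|M. H (\<lambda>p\<in>{1..P}. \<xi> p \<omega>)) = (LINT \<omega>|M. H (\<lambda>p\<in>{1..P}. T (\<xi> p \<omega>)))"
  proof (cases "{1..P} = {}")
    case False
    have eq: "distr M (\<Pi>\<^sub>M p\<in>{1..P}. borel) (\<lambda>\<omega>. \<lambda>p\<in>{1..P}. \<eta> p \<omega>) = (\<Pi>\<^sub>M p\<in>{1..P}. uniform_sphere)"
      if "indep_vars (\<lambda>_. borel) \<eta> {1..P}"
        and "\<And>p. p \<in> {1..P} \<Longrightarrow> distr M borel (\<eta> p) = uniform_sphere"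
      for \<eta> :: "nat \<Rightarrow> 'w \<Rightarrow> real ^ 'n"
    proof -
      have "\<And>p. p \<in> {1..P} \<Longrightarrow> random_variable borel (\<eta> p)"
        using that(1) by (auto simp: indep_vars_def)
      then have "distr M (\<Pi>\<^sub>M p\<in>{1..P}. borel) (\<lambda>\<omega>. \<lambda>p\<in>{1..P}. \<eta> p \<omega>)
          = (\<Pi>\<^sub>M p\<in>{1..P}. distr M borel (\<eta> p))"
        using that(1) indep_vars_iff_distr_eq_PiM'[OF False, where M' = "\<lambda>_. borel" and X = \<eta>] by blast
      also have "\<dots> = (\<Pi>\<^sub>M p\<in>{1..P}. uniform_sphere)"
        by (rule PiM_cong) (simp_all add: that(2))
      finally show ?thesis .
    qed
    have "distr M borel (\<lambda>\<omega>. T (\<xi> p \<omega>)) = uniform_sphere" if "p \<in> {1..P}" for p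
    proof -
      have "distr M borel (\<lambda>\<omega>. T (\<xi> p \<omega>)) = distr (distr M borel (\<xi> p)) borel T"
        using rv[OF that] by (subst distr_distr) (simp_all add: comp_def)
      then show ?thesis
        by (simp add: unif[OF that] uniform_sphere_rotation_invariant[OF T])
    qed
    moreover have "indep_vars (\<lambda>_. borel) (\<lambda>p \<omega>. T (\<xi> p \<omega>)) {1..P}"
      by (rule indep_vars_compose2[OF indep]) simp
    ultimately have "distr M (\<Pi>\<^sub>M p\<in>{1..P}. borel) (\<lambda>\<omega>. \<lambda>p\<in>{1..P}. \<xi> p \<omega>)
        = distr M (\<Pi>\<^sub>M p\<in>{1..P}. borel) (\<lambda>\<omega>. \<lambda>p\<in>{1..P}. T (\<xi> p \<omega>))"
      using eq[OF indep unif] eq[of "\<lambda>p \<omega>. T (\<xi> p \<omega>)"] by simp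
    then have "(LINT v|distr M (\<Pi>\<^sub>M p\<in>{1..P}. borel) (\<lambda>\<omega>. \<lambda>p\<in>{1..P}. \<xi> p \<omega>). H v)
        = (LINT v|distr M (\<Pi>\<^sub>M p\<in>{1..P}. borel) (\<lambda>\<omega>. \<lambda>p\<in>{1..P}. T (\<xi> p \<omega>)). H v)"
      by simp
    moreover have "(\<lambda>\<omega>. \<lambda>p\<in>{1..P}. \<xi> p \<omega>) \<in> measurable M (\<Pi>\<^sub>M p\<in>{1..P}. borel)"
      "(\<lambda>\<omega>. \<lambda>p\<in>{1..P}. T (\<xi> p \<omega>)) \<in> measurable M (\<Pi>\<^sub>M p\<in>{1..P}. borel)"
      using measurable_compose[OF rv Tm] by (auto intro!: measurable_restrict rv)
    ultimately show ?thesis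
      using Hm by (simp only: integral_distr)
  qed (simp add: H_def)
  moreover have "T v \<bullet> y = v \<bullet> x" for v
    using T by (simp add: Tx[symmetric] orthogonal_transformation_def)
  ultimately have *: "(LINT \<omega>|M. ((1 / real P) * (\<Sum>p=1..P. f \<bar>\<xi> p \<omega> \<bullet> y\<bar>) - F (norm y))\<^sup>2)
      = (LINT \<omega>|M. ((1 / real P) * (\<Sum>p=1..P. f \<bar>\<xi> p \<omega> \<bullet> x\<bar>) - F (norm x))\<^sup>2)"
    by (simp add: H_def x y)
  have rmse: "slicing_rmse M \<xi> P f F s =
      sqrt (LINT \<omega>|M. ((1 / real P) * (\<Sum>p=1..P. f \<bar>\<xi> p \<omega> \<bullet> y\<bar>) - F (norm y))\<^sup>2)"
    by (simp add: slicing_rmse_def y_def Let_def)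
  show "0 \<le> slicing_rmse M \<xi> P f F s"
    unfolding rmse by (intro real_sqrt_ge_zero integral_nonneg_AE) simp
  show "(slicing_rmse M \<xi> P f F s)\<^sup>2 =
      (LINT \<omega>|M. ((1 / real P) * (\<Sum>p=1..P. f \<bar>\<xi> p \<omega> \<bullet> x\<bar>) - F (norm x))\<^sup>2)"
    unfolding rmse * by (intro real_sqrt_pow2 integral_nonneg_AE) simp
qed


section \<open>Norms on the unit interval\<close>

text \<open>All norms take values in the extended nonnegative reals and are infinite outside the space.\<close>

definition ennreal_root :: "real \<Rightarrow> ennreal \<Rightarrow> ennreal" where
  "ennreal_root p x = (if x = \<infinity> then \<infinity> else ennreal (enn2real x powr (1 / p)))"

definition Lp_norm :: "real \<Rightarrow> (real \<Rightarrow> real) \<Rightarrow> (real \<Rightarrow> real) \<Rightarrow> ennreal" where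
  "Lp_norm p w f =
     ennreal_root p (\<integral>\<^sup>+s. ennreal (\<bar>f s\<bar> powr p * w s) \<partial>lebesgue_on {0..1})"

abbreviation L2_norm :: "(real \<Rightarrow> real) \<Rightarrow> ennreal" where
  "L2_norm \<equiv> Lp_norm 2 (\<lambda>_. 1)"

definition Linf_norm :: "(real \<Rightarrow> real) \<Rightarrow> ennreal" where
  "Linf_norm f = esssup (lebesgue_on {0..1}) (\<lambda>s. ennreal \<bar>f s\<bar>)"

lemma Lp_norm_2_square:
  "(Lp_norm 2 w f)\<^sup>2 = (\<integral>\<^sup>+s. ennreal ((f s)\<^sup>2 * w s) \<partial>lebesgue_on {0..1})"
proof -
  have "\<bar>r\<bar> powr 2 = r\<^sup>2" for r :: real
    by (cases "r = 0") simp_all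
  moreover have "(ennreal_root 2 x)\<^sup>2 = x" for x
    by (cases x) (simp_all add: ennreal_root_def ennreal_power powr_half_sqrt)
  ultimately show ?thesis by (simp add: Lp_norm_def)
qed

definition in_L2 :: "(real \<Rightarrow> real) \<Rightarrow> bool" where
  "in_L2 f \<longleftrightarrow> f \<in> borel_measurable (lebesgue_on {0..1}) \<and> L2_norm f < \<infinity>"

text \<open>Continuously differentiable test functions with compact support in the open interval.\<close>

definition test_fun :: "(real \<Rightarrow> real) \<Rightarrow> bool" where
  "test_fun \<phi> \<longleftrightarrow>
     (\<forall>x. \<phi> differentiable at x) \<and> continuous_on UNIV (deriv \<phi>) \<and>
     (\<exists>a b. 0 < a \<and> b < 1 \<and> (\<forall>x. x \<notin> {a..b} \<longrightarrow> \<phi> x = 0))"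

definition weak_deriv_L2 :: "(real \<Rightarrow> real) \<Rightarrow> (real \<Rightarrow> real) \<Rightarrow> bool" where
  "weak_deriv_L2 f g \<longleftrightarrow> in_L2 g \<and>
     (\<forall>\<phi>. test_fun \<phi> \<longrightarrow>
        (LINT x|lebesgue_on {0..1}. f x * deriv \<phi> x) = - (LINT x|lebesgue_on {0..1}. g x * \<phi> x))"

definition in_H1 :: "(real \<Rightarrow> real) \<Rightarrow> bool" where
  "in_H1 f \<longleftrightarrow> in_L2 f \<and> (\<exists>g. weak_deriv_L2 f g)"

text \<open>Weak derivatives agree almost everywhere, so the norm does not depend on the chosen one.\<close>

definition H1_norm :: "(real \<Rightarrow> real) \<Rightarrow> ennreal" where
  "H1_norm f =
     (if in_H1 f then ennreal_root 2 ((L2_norm f)\<^sup>2 + (L2_norm (SOME g. weak_deriv_L2 f g))\<^sup>2)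
      else \<infinity>)"

end

(*
The law of <xi, b> for xi uniform on the sphere is found by integrating phi(<x, b>) over the thin
shell between the balls of radius R and 1. As R tends to 1, the shell integral divided by 1 - R
becomes the spherical mean, whereas Cavalieri's principle turns it into the integral of phi against
the derivative of the slice volumes in R; the constants match because of the volume of the unit ball.
Hence the expectation of f(|<xi, x>|) is S_d[f](s), and independence gives
E(s)^2 = (S_d[f^2](s) - S_d[f](s)^2) / P + (F(s) - S_d[f](s))^2.
The first inequality follows from S_d[f^2](s) <= (c_d / s) ||f||^2, the second one from the Sobolev
inequality g(s)^2 <= 2 ||g||^2 in H^1, applied to f and to F - S_d[f].
*)

theory Submission
  imports Defs
begin

text \<open>The sphere measure is an image of the ball under \<open>sgn\<close>, and
  \<open>sgn x \<bullet> b\<close> depends on all coordinates of \<open>x\<close>, so Cavalieri's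
  principle does not apply to it directly. On a thin shell it may be exchanged for the coordinate
  \<open>x \<bullet> b\<close>; this is the reason for the passage to a limit. The price is
  continuity of the integrand, which cosine polynomials have on the whole line. Differentiating in
  the radius also explains the exponent of the density: slice volumes carry (r^2 - u^2)^((d-1)/2),
  and one derivative lowers the exponent to (d-3)/2. In the second inequality H^1 is given by weak
  derivatives, so point values have to be extracted from the identity against test functions, by
  steps that approximate the indicator of an interval. The constant 2 comes from splitting a square
  of a sum. The variance term additionally relies on the slicing operator being an average: a bound
  by the factor c_d, as in the first inequality, would be too weak there.\<close>

section \<open>Slices and shells of the ball\<close>

text \<open>The slice is empty for \<open>\<bar>u\<bar> > r\<close>; \<open>max 0\<close> is needed since \<open>sqrt\<close> is odd and negative on negative numbers.\<close>

lemma nn_integral_cball_inner_Basis: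
  fixes b :: "'a::euclidean_space"
  assumes b: "b \<in> Basis" and r: "0 < r" and dim: "2 \<le> DIM('a)"
    and g [measurable]: "g \<in> borel_measurable borel"
  shows "(\<integral>\<^sup>+x. g (x \<bullet> b) * indicator (cball 0 r) x \<partial>lborel) =
    (\<integral>\<^sup>+u. g u * ennreal (unit_ball_vol (real (DIM('a) - 1)) * sqrt (max 0 (r\<^sup>2 - u\<^sup>2)) ^ (DIM('a) - 1)) \<partial>lborel)"
proof -
  interpret product_sigma_finite "\<lambda>_. lborel :: real measure" by standard
  define A where "A = (Basis :: 'a set) - {b}"
  have Basis: "Basis = insert b A" and finA [simp]: "finite A" and nb: "b \<notin> A"
    using b by (auto simp: A_def)
  have cardA: "card A = DIM('a) - 1"
    using b by (simp add: A_def)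
  have nsq: "norm (\<Sum>i\<in>Basis. f i *\<^sub>R i :: 'a) \<le> r \<longleftrightarrow> (f b)\<^sup>2 + (\<Sum>i\<in>A. (f i)\<^sup>2) \<le> r\<^sup>2"
    for f :: "'a \<Rightarrow> real"
  proof -
    have "(norm (\<Sum>i\<in>Basis. f i *\<^sub>R i :: 'a))\<^sup>2 = (\<Sum>i\<in>Basis. (f i)\<^sup>2)"
      unfolding power2_norm_eq_inner
      by (subst euclidean_inner) (simp add: inner_sum_left inner_Basis if_distrib power2_eq_square cong: if_cong)
    also have "\<dots> = (f b)\<^sup>2 + (\<Sum>i\<in>A. (f i)\<^sup>2)"
      using nb by (simp add: Basis)
    finally show ?thesis
      using r by (metis abs_le_square_iff abs_norm_cancel abs_of_pos)
  qed
  \<comment> \<open>The two slices at the boundary are left out because the volume formula is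
    applied with a positive radius; as a null set of \<open>y\<close> they do not affect the
    integral.\<close>
  have slice: "(\<integral>\<^sup>+x. indicator {f. y\<^sup>2 + (\<Sum>i\<in>A. (f i)\<^sup>2) \<le> r\<^sup>2} x \<partial>Pi\<^sub>M A (\<lambda>_. lborel)) =
      ennreal (unit_ball_vol (real (DIM('a) - 1)) * sqrt (max 0 (r\<^sup>2 - y\<^sup>2)) ^ (DIM('a) - 1))"
    if y: "y \<notin> {-r, r}" for y
  proof (cases "y\<^sup>2 < r\<^sup>2")
    case True
    have "(\<integral>\<^sup>+x. indicator {f. y\<^sup>2 + (\<Sum>i\<in>A. (f i)\<^sup>2) \<le> r\<^sup>2} x \<partial>Pi\<^sub>M A (\<lambda>_. lborel)) =
      (\<integral>\<^sup>+x. indicator ({f. sqrt (\<Sum>i\<in>A. (f i)\<^sup>2) \<le> sqrt (r\<^sup>2 - y\<^sup>2)} \<inter> space (Pi\<^sub>M A (\<lambda>_. lborel))) x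
        \<partial>Pi\<^sub>M A (\<lambda>_. lborel))"
      by (intro nn_integral_cong) (auto simp: indicator_def)
    also have "\<dots> = emeasure (Pi\<^sub>M A (\<lambda>_. lborel))
        ({f. sqrt (\<Sum>i\<in>A. (f i)\<^sup>2) \<le> sqrt (r\<^sup>2 - y\<^sup>2)} \<inter> space (Pi\<^sub>M A (\<lambda>_. lborel)))"
      by (intro nn_integral_indicator) measurable
    also have "\<dots> = ennreal (unit_ball_vol (real (card A)) * sqrt (r\<^sup>2 - y\<^sup>2) ^ card A)"
      using True by (intro emeasure_cball_aux) auto
    finally show ?thesis
      using True by (simp add: cardA)
  next
    case False
    have "y\<^sup>2 \<noteq> r\<^sup>2"
      using y r by (auto simp: power2_eq_iff)
    with False have "r\<^sup>2 < y\<^sup>2" by simp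
    then have "\<not> y\<^sup>2 + (\<Sum>i\<in>A. (f i)\<^sup>2) \<le> r\<^sup>2" for f
      using sum_nonneg[of A "\<lambda>i. (f i)\<^sup>2"] by (smt (verit) zero_le_power2)
    then have "(\<integral>\<^sup>+x. indicator {f. y\<^sup>2 + (\<Sum>i\<in>A. (f i)\<^sup>2) \<le> r\<^sup>2} x \<partial>Pi\<^sub>M A (\<lambda>_. lborel)) = 0"
      by simp
    \<comment> \<open>An empty slice has to match a power of 0. This power is 0, and not 1, because
      \<open>dim\<close> makes the exponent positive.\<close>
    then show ?thesis
      using \<open>r\<^sup>2 < y\<^sup>2\<close> dim by (simp add: zero_power)
  qed
  have "(\<integral>\<^sup>+x. g (x \<bullet> b) * indicator (cball 0 r) x \<partial>lborel) =
    (\<integral>\<^sup>+f. g (f b) * indicator {f. (f b)\<^sup>2 + (\<Sum>i\<in>A. (f i)\<^sup>2) \<le> r\<^sup>2} f \<partial>Pi\<^sub>M Basis (\<lambda>_. lborel))"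
    using b
    by (subst lborel_eq, subst nn_integral_distr)
       (auto simp: inner_sum_left inner_Basis if_distrib cong: if_cong
         intro!: nn_integral_cong simp: indicator_def nsq)
  also have "\<dots> = (\<integral>\<^sup>+y. \<integral>\<^sup>+x. g y * indicator {f. y\<^sup>2 + (\<Sum>i\<in>A. (f i)\<^sup>2) \<le> r\<^sup>2} x
      \<partial>Pi\<^sub>M A (\<lambda>_. lborel) \<partial>lborel)"
  proof -
    have "(\<Sum>i\<in>A. (if i = b then y else f i)\<^sup>2) = (\<Sum>i\<in>A. (f i)\<^sup>2)" for f :: "'a \<Rightarrow> real" and y
      using nb by (intro sum.cong) auto
    then show ?thesis
      unfolding Basis using nb
      by (subst product_nn_integral_insert_rev) (auto simp: indicator_def intro!: nn_integral_cong)
  qed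
  also have "\<dots> = (\<integral>\<^sup>+y. g y * (\<integral>\<^sup>+x. indicator {f. y\<^sup>2 + (\<Sum>i\<in>A. (f i)\<^sup>2) \<le> r\<^sup>2} x
      \<partial>Pi\<^sub>M A (\<lambda>_. lborel)) \<partial>lborel)"
    by (intro nn_integral_cong nn_integral_cmult) measurable
  also have "\<dots> = (\<integral>\<^sup>+u. g u * ennreal (unit_ball_vol (real (DIM('a) - 1)) *
      sqrt (max 0 (r\<^sup>2 - u\<^sup>2)) ^ (DIM('a) - 1)) \<partial>lborel)"
  proof (rule nn_integral_cong_AE)
    have "AE y in lborel. y \<notin> {-r, r}"
      by (intro AE_not_in countable_imp_null_set_lborel) auto
    then show "AE y in lborel. g y * (\<integral>\<^sup>+x. indicator {f. y\<^sup>2 + (\<Sum>i\<in>A. (f i)\<^sup>2) \<le> r\<^sup>2} x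
      \<partial>Pi\<^sub>M A (\<lambda>_. lborel)) = g y * ennreal (unit_ball_vol (real (DIM('a) - 1)) *
      sqrt (max 0 (r\<^sup>2 - y\<^sup>2)) ^ (DIM('a) - 1))"
    proof eventually_elim
      case (elim y)
      then show ?case by (subst slice) auto
    qed
  qed
  finally show ?thesis .
qed

text \<open>For indicator functions the nonnegative formula identifies two measures: the image of
  the ball under a coordinate, and the density formed by the slice volumes. Signed integrands follow
  from this equality of measures, with no split into positive and negative parts.\<close>

lemma integral_cball_inner_Basis:
  fixes b :: "'a::euclidean_space" and \<phi> :: "real \<Rightarrow> real"
  assumes b: "b \<in> Basis" and r: "0 < r" and dim: "2 \<le> DIM('a)"
    and \<phi> [measurable]: "\<phi> \<in> borel_measurable borel"
  shows "(LINT x:cball 0 r|lborel. \<phi> (x \<bullet> b)) =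
    (LINT u|lborel. unit_ball_vol (real (DIM('a) - 1)) * sqrt (max 0 (r\<^sup>2 - u\<^sup>2)) ^ (DIM('a) - 1) * \<phi> u)"
proof -
  let ?q = "\<lambda>u. unit_ball_vol (real (DIM('a) - 1)) * sqrt (max 0 (r\<^sup>2 - u\<^sup>2)) ^ (DIM('a) - 1)"
  let ?N = "density lborel (indicator (cball 0 r)) :: 'a measure"
  have [measurable]: "cball (0::'a) r \<in> sets borel"
    by (intro borel_closed) simp
  have law: "distr ?N borel (\<lambda>x. x \<bullet> b) = density lborel ?q"
  proof (rule measure_eqI)
    fix A assume "A \<in> sets (distr ?N borel (\<lambda>x. x \<bullet> b))"
    then have A [measurable]: "A \<in> sets borel" by simp
    have "emeasure (distr ?N borel (\<lambda>x. x \<bullet> b)) A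
        = (\<integral>\<^sup>+x. indicator A (x \<bullet> b) * indicator (cball 0 r) x \<partial>lborel)"
    proof -
      have "emeasure (distr ?N borel (\<lambda>x. x \<bullet> b)) A = (\<integral>\<^sup>+x. indicator A (x \<bullet> b) \<partial>?N)"
        by (subst nn_integral_indicator[symmetric], simp, subst nn_integral_distr) auto
      also have "\<dots> = (\<integral>\<^sup>+x. indicator A (x \<bullet> b) * indicator (cball 0 r) x \<partial>lborel)"
        by (subst nn_integral_density) (auto simp: mult.commute)
      finally show ?thesis .
    qed
    also have "\<dots> = emeasure (density lborel ?q) A"
      by (subst nn_integral_cball_inner_Basis[OF b r dim])
         (auto simp: emeasure_density mult.commute)
    finally show "emeasure (distr ?N borel (\<lambda>x. x \<bullet> b)) A = emeasure (density lborel ?q) A" .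
  qed simp
  have "(LINT x:cball 0 r|lborel. \<phi> (x \<bullet> b)) = (LINT x|?N. \<phi> (x \<bullet> b))"
    unfolding set_lebesgue_integral_def
    by (subst integral_density[symmetric, where g = "indicator _"]) (auto simp: ennreal_indicator)
  also have "\<dots> = (LINT u|density lborel ?q. \<phi> u)"
    by (subst law[symmetric], subst integral_distr) auto
  also have "\<dots> = (LINT u|lborel. ?q u * \<phi> u)"
    by (subst integral_density) auto
  finally show ?thesis .
qed

text \<open>A dilation changes the integral of a function homogeneous of degree 0 only by the
  Jacobian. It serves both the angular integrand \<open>\<phi> (sgn x \<bullet> b)\<close> and the
  constant 1, whose integral is the volume.\<close>

lemma set_integral_cball_scale:
  fixes \<psi> :: "'a::euclidean_space \<Rightarrow> real"
  assumes [measurable]: "\<psi> \<in> borel_measurable borel" and r: "0 < r"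
    and hom: "\<And>c x. 0 < c \<Longrightarrow> \<psi> (c *\<^sub>R x) = \<psi> x"
  shows "(LINT x:cball 0 r|lborel. \<psi> x) = r ^ DIM('a) * (LINT x:cball 0 1|lborel. \<psi> x)"
proof -
  have [measurable]: "cball (0::'a) \<rho> \<in> sets borel" for \<rho>
    by (intro borel_closed) simp
  have ind: "indicator (cball 0 r) (r *\<^sub>R x) = (indicator (cball 0 1) x :: real)" for x :: 'a
    using r by (simp add: indicator_def)
  have aff: "(lborel :: 'a measure) = density (distr lborel borel (\<lambda>x. 0 + r *\<^sub>R x)) (\<lambda>_. ennreal (\<bar>r\<bar> ^ DIM('a)))"
    using r lborel_affine[of r 0] by simp
  have "(LINT x:cball 0 r|lborel. \<psi> x) = (LINT x|density (distr lborel borel (\<lambda>x. 0 + r *\<^sub>R x))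
      (\<lambda>_. ennreal (\<bar>r\<bar> ^ DIM('a))). indicator (cball 0 r) x * \<psi> x)"
    unfolding set_lebesgue_integral_def real_scaleR_def by (subst aff) (rule refl)
  also have "\<dots> = r ^ DIM('a) * (LINT x:cball 0 1|lborel. \<psi> x)"
    using r by (simp add: integral_density integral_distr hom ind set_lebesgue_integral_def)
  finally show ?thesis .
qed

section \<open>The derivative of slice integrals with respect to the radius\<close>

text \<open>This is the domination for the difference quotient, uniform in \<open>u\<close>. In the
  factorisation of A^m - B^m every summand beside A - B is at most A; the factor A saved in this way
  turns A - B into A^2 - B^2, where the square roots disappear. For m = 1 no such factor is left,
  and the quotient is unbounded near \<bar>u\<bar> = 1.\<close>

lemma sqrt_diff_power_le:
  fixes u R :: real
  assumes R: "0 \<le> R" "R \<le> 1" and m: "2 \<le> m"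
  shows "\<bar>sqrt (max 0 (1 - u\<^sup>2)) ^ m - sqrt (max 0 (R\<^sup>2 - u\<^sup>2)) ^ m\<bar> \<le> 2 * real m * (1 - R)"
proof -
  define A where "A = sqrt (max 0 (1 - u\<^sup>2))"
  define B where "B = sqrt (max 0 (R\<^sup>2 - u\<^sup>2))"
  have R2: "R\<^sup>2 \<le> 1" using R by (simp add: power_le_one)
  have B0: "0 \<le> B" and BA: "B \<le> A" and A1: "A \<le> 1"
    using R2 by (auto simp: A_def B_def)
  have AB: "A\<^sup>2 - B\<^sup>2 \<le> 1 - R\<^sup>2"
    using R2 by (auto simp: A_def B_def max_def)
  have "A ^ m - B ^ m = (A - B) * (\<Sum>i<m. A ^ i * B ^ (m - Suc i))"
    by (simp add: power_diff_sumr2 mult.commute)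
  also have "(\<Sum>i<m. A ^ i * B ^ (m - Suc i)) \<le> (\<Sum>i<m. A)"
  proof (rule sum_mono)
    fix i assume "i \<in> {..<m}"
    then have i: "i + (m - Suc i) = m - 1" by auto
    have "A ^ i * B ^ (m - Suc i) \<le> A ^ i * A ^ (m - Suc i)"
      using B0 BA by (intro mult_left_mono power_mono) auto
    also have "\<dots> = A ^ (m - 1)"
      by (simp only: power_add[symmetric] i)
    also have "\<dots> \<le> A ^ 1"
      using m A1 B0 BA by (intro power_decreasing) auto
    finally show "A ^ i * B ^ (m - Suc i) \<le> A" by simp
  qed
  then have "(A - B) * (\<Sum>i<m. A ^ i * B ^ (m - Suc i)) \<le> (A - B) * (m * A)"
    using BA by (intro mult_left_mono) auto
  also have "\<dots> \<le> real m * (A\<^sup>2 - B\<^sup>2)"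
  proof -
    have "(A - B) * A \<le> (A - B) * (A + B)"
      using BA B0 by (intro mult_left_mono) auto
    also have "\<dots> = A\<^sup>2 - B\<^sup>2" by (simp add: algebra_simps power2_eq_square)
    finally have "real m * ((A - B) * A) \<le> real m * (A\<^sup>2 - B\<^sup>2)"
      by (intro mult_left_mono) auto
    then show ?thesis by (simp add: mult_ac)
  qed
  also have "\<dots> \<le> real m * (1 - R\<^sup>2)"
    using AB by (intro mult_left_mono) auto
  also have "\<dots> \<le> real m * (2 * (1 - R))"
  proof (intro mult_left_mono)
    have "0 \<le> (1 - R)\<^sup>2" by simp
    then show "1 - R\<^sup>2 \<le> 2 * (1 - R)" by (simp add: power2_eq_square algebra_simps)
  qed simp
  finally have "A ^ m - B ^ m \<le> 2 * real m * (1 - R)" by (simp add: algebra_simps)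
  moreover have "B ^ m \<le> A ^ m" using BA B0 by (rule power_mono)
  ultimately show ?thesis by (simp add: A_def B_def)
qed

text \<open>Differentiation under the integral sign at radius 1, by dominated convergence. Outside
  [-1, 1] both slices are empty; inside, the quotient tends to the derivative of (r^2 - u^2)^(m/2)
  at r = 1.\<close>

lemma slice_difference_quotient_tendsto:
  fixes \<phi> :: "real \<Rightarrow> real"
  assumes \<phi>: "continuous_on UNIV \<phi>" and m: "2 \<le> m"
    and R: "R \<longlonglongrightarrow> 1" "\<And>n. 0 \<le> R n" "\<And>n. R n < (1::real)"
  shows "(\<lambda>n. LINT u|lborel. (sqrt (max 0 (1 - u\<^sup>2)) ^ m - sqrt (max 0 ((R n)\<^sup>2 - u\<^sup>2)) ^ m) / (1 - R n) * \<phi> u)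
    \<longlonglongrightarrow> (LINT u:{-1..1}|lborel. real m * sqrt (1 - u\<^sup>2) ^ (m - 2) * \<phi> u)"
proof -
  have [measurable]: "\<phi> \<in> borel_measurable borel"
    using \<phi> by (rule borel_measurable_continuous_onI)
  have "compact (\<phi> ` {-1..1})"
    using \<phi> by (intro compact_continuous_image) (auto intro: continuous_on_subset)
  then obtain C where C: "\<And>u. u \<in> {-1..1} \<Longrightarrow> \<bar>\<phi> u\<bar> \<le> C"
    using that by (force dest!: compact_imp_bounded simp: bounded_iff)
  show ?thesis
    unfolding set_lebesgue_integral_def real_scaleR_def
  proof (rule integral_dominated_convergence[where w = "\<lambda>u. indicator {-1..1} u * (2 * real m * C)"])
    show "integrable lborel (\<lambda>u::real. indicator {-1..1} u * (2 * real m * C))"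
      by (intro integrable_mult_left integrable_real_indicator) auto
    show "AE u in lborel. norm ((sqrt (max 0 (1 - u\<^sup>2)) ^ m - sqrt (max 0 ((R n)\<^sup>2 - u\<^sup>2)) ^ m) / (1 - R n) * \<phi> u)
        \<le> indicator {-1..1} u * (2 * real m * C)" for n
    proof (rule AE_I2)
      fix u :: real
      show "norm ((sqrt (max 0 (1 - u\<^sup>2)) ^ m - sqrt (max 0 ((R n)\<^sup>2 - u\<^sup>2)) ^ m) / (1 - R n) * \<phi> u)
        \<le> indicator {-1..1} u * (2 * real m * C)"
      proof (cases "u \<in> {-1..1}")
        case True
        have "\<bar>sqrt (max 0 (1 - u\<^sup>2)) ^ m - sqrt (max 0 ((R n)\<^sup>2 - u\<^sup>2)) ^ m\<bar> / (1 - R n) \<le> 2 * real m"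
          using sqrt_diff_power_le[of "R n" m u] R(2,3)[of n] m by (simp add: divide_le_eq)
        then have "\<bar>sqrt (max 0 (1 - u\<^sup>2)) ^ m - sqrt (max 0 ((R n)\<^sup>2 - u\<^sup>2)) ^ m\<bar> / (1 - R n) * \<bar>\<phi> u\<bar>
            \<le> 2 * real m * C"
          using C[OF True] by (intro mult_mono) auto
        with True R(3)[of n] show ?thesis
          by (simp add: abs_mult)
      next
        case False
        then have "1 < \<bar>u\<bar>" by auto
        then have "1 < u\<^sup>2" by (metis abs_one one_power2 power2_abs power_strict_mono abs_ge_zero zero_less_numeral zero_le_one)
        moreover have "(R n)\<^sup>2 \<le> 1" using R(2,3)[of n] by (intro power_le_one) auto
        ultimately have "sqrt (max 0 (1 - u\<^sup>2)) = 0" "sqrt (max 0 ((R n)\<^sup>2 - u\<^sup>2)) = 0"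
          by auto
        with False show ?thesis by simp
      qed
    qed
    \<comment> \<open>These two points are genuine exceptions when m = 2, that is d = 3: the
      quotient is 0 there, whereas 0^0 = 1 gives the limit integrand the value
      \<open>2 * \<phi> u\<close>.\<close>
    have "AE u in lborel. u \<notin> {-1, 1::real}"
      by (intro AE_not_in countable_imp_null_set_lborel) auto
    then show "AE u in lborel. (\<lambda>n. (sqrt (max 0 (1 - u\<^sup>2)) ^ m - sqrt (max 0 ((R n)\<^sup>2 - u\<^sup>2)) ^ m) / (1 - R n) * \<phi> u)
        \<longlonglongrightarrow> indicator {-1..1} u * (real m * sqrt (1 - u\<^sup>2) ^ (m - 2) * \<phi> u)"
    proof eventually_elim
      case (elim u)
      show ?case
      proof (cases "\<bar>u\<bar> < 1")
        case True
        then have u2: "u\<^sup>2 < 1" by (simp add: abs_square_less_1)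
        define s where "s = sqrt (1 - u\<^sup>2)"
        have s: "0 < s" using u2 by (simp add: s_def)
        have "((\<lambda>r. sqrt (r\<^sup>2 - u\<^sup>2) ^ m) has_real_derivative
            (real m * s ^ (m - 1) * (inverse s / 2 * 2))) (at 1)"
          using u2 by (auto intro!: derivative_eq_intros simp: s_def)
        moreover have "real m * s ^ (m - 1) * (inverse s / 2 * 2) = real m * s ^ (m - 2)"
        proof -
          have "m - 1 = Suc (m - 2)" using m by simp
          then show ?thesis using s by simp
        qed
        ultimately have "((\<lambda>r. sqrt (r\<^sup>2 - u\<^sup>2) ^ m) has_real_derivative real m * s ^ (m - 2)) (at 1)"
          by (simp only:)
        then have "((\<lambda>r. (sqrt (r\<^sup>2 - u\<^sup>2) ^ m - s ^ m) / (r - 1)) \<longlongrightarrow> real m * s ^ (m - 2)) (at 1)"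
          by (simp add: has_field_derivative_iff s_def)
        moreover have "filterlim R (at 1) sequentially"
          using R(1,3) by (auto simp: filterlim_at intro!: always_eventually) (metis less_irrefl)
        ultimately have "(\<lambda>n. (sqrt ((R n)\<^sup>2 - u\<^sup>2) ^ m - s ^ m) / (R n - 1)) \<longlonglongrightarrow> real m * s ^ (m - 2)"
          by (rule filterlim_compose)
        moreover have "\<forall>\<^sub>F n in sequentially. (sqrt ((R n)\<^sup>2 - u\<^sup>2) ^ m - s ^ m) / (R n - 1) =
          (sqrt (max 0 (1 - u\<^sup>2)) ^ m - sqrt (max 0 ((R n)\<^sup>2 - u\<^sup>2)) ^ m) / (1 - R n)"
        proof -
          have "\<forall>\<^sub>F n in sequentially. u\<^sup>2 < (R n)\<^sup>2"
            using tendsto_power[OF R(1), of 2] u2 by (intro order_tendstoD) auto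
          then show ?thesis
          proof eventually_elim
            case (elim n)
            then show ?case
              using u2 minus_divide_divide[of "s ^ m - sqrt ((R n)\<^sup>2 - u\<^sup>2) ^ m" "1 - R n"]
              by (simp add: s_def)
          qed
        qed
        ultimately have "(\<lambda>n. (sqrt (max 0 (1 - u\<^sup>2)) ^ m - sqrt (max 0 ((R n)\<^sup>2 - u\<^sup>2)) ^ m) / (1 - R n))
          \<longlonglongrightarrow> real m * s ^ (m - 2)"
          by (rule Lim_transform_eventually)
        from tendsto_mult[OF this tendsto_const[of "\<phi> u"]] show ?thesis
          using True by (simp add: s_def abs_less_iff)
      next
        case False
        with elim have u1: "1 < \<bar>u\<bar>" by (auto simp: abs_if split: if_splits)
        then have "1 < u\<^sup>2" by (metis abs_one one_power2 power2_abs power_strict_mono abs_ge_zero zero_less_numeral zero_le_one)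
        moreover have "(R n)\<^sup>2 \<le> 1" for n using R(2,3)[of n] by (intro power_le_one) auto
        ultimately have "sqrt (max 0 (1 - u\<^sup>2)) = 0" "sqrt (max 0 ((R n)\<^sup>2 - u\<^sup>2)) = 0" for n
          by (auto simp: max_def) (smt (verit))
        with u1 show ?thesis by (auto simp: indicator_def)
      qed
    qed
  qed measurable
qed

text \<open>On a thin shell, \<open>x\<close> and \<open>sgn x\<close> are close, and \<open>sgn\<close> makes the integrand homogeneous of degree 0.\<close>

lemma shell_difference_quotient_tendsto:
  fixes b :: "'a::euclidean_space" and \<phi> :: "real \<Rightarrow> real"
  assumes b: "b \<in> Basis" and \<phi>: "continuous_on UNIV \<phi>"
    and R: "R \<longlonglongrightarrow> 1" "\<And>n. 0 < R n" "\<And>n. R n < (1::real)"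
  shows "(\<lambda>n. ((LINT x:cball 0 1|lborel. \<phi> (x \<bullet> b)) - (LINT x:cball 0 (R n)|lborel. \<phi> (x \<bullet> b))) / (1 - R n))
    \<longlonglongrightarrow> DIM('a) * (LINT x:cball 0 1|lborel. \<phi> (sgn x \<bullet> b))"
proof -
  have [measurable]: "\<phi> \<in> borel_measurable borel"
    using \<phi> by (rule borel_measurable_continuous_onI)
  have [measurable]: "cball (0::'a) \<rho> \<in> sets borel" for \<rho>
    by (intro borel_closed) simp
  have fin: "emeasure lborel (cball (0::'a) \<rho>) < \<infinity>" for \<rho>
    by (rule emeasure_bounded_finite) simp
  have "compact (\<phi> ` {-1..1})"
    using \<phi> by (intro compact_continuous_image) (auto intro: continuous_on_subset)
  then obtain C where C: "\<And>u. u \<in> {-1..1} \<Longrightarrow> \<bar>\<phi> u\<bar> \<le> C"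
    by (force dest!: compact_imp_bounded simp: bounded_iff)
  have inner_le: "\<bar>x \<bullet> b\<bar> \<le> norm x" for x :: 'a
    using b by (rule Basis_le_norm)
  have int1: "set_integrable lborel (cball 0 \<rho>) (\<lambda>x. \<phi> (x \<bullet> b))" if "\<rho> \<le> 1" for \<rho>
    unfolding set_integrable_def
  proof (rule integrableI_bounded_set_indicator[where B = C])
    show "AE x in lborel. x \<in> cball 0 \<rho> \<longrightarrow> norm (\<phi> (x \<bullet> b)) \<le> C"
    proof (intro AE_I2 impI)
      fix x :: 'a
      assume "x \<in> cball 0 \<rho>"
      then have "\<bar>x \<bullet> b\<bar> \<le> 1"
        using that inner_le[of x] by simp
      then show "norm (\<phi> (x \<bullet> b)) \<le> C"
        by (auto intro!: C)
    qed
  qed (use fin in auto)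
  have int2: "set_integrable lborel (cball 0 \<rho>) (\<lambda>x. \<phi> (sgn x \<bullet> b))" for \<rho>
    unfolding set_integrable_def
  proof (rule integrableI_bounded_set_indicator[where B = C])
    show "AE x in lborel. x \<in> cball 0 \<rho> \<longrightarrow> norm (\<phi> (sgn x \<bullet> b)) \<le> C"
    proof (intro AE_I2 impI)
      fix x :: 'a
      have "\<bar>sgn x \<bullet> b\<bar> \<le> 1"
        using inner_le[of "sgn x"] norm_sgn[of x] by (auto split: if_splits)
      then show "norm (\<phi> (sgn x \<bullet> b)) \<le> C"
        by (auto intro!: C)
    qed
  qed (use fin in auto)
  have int3: "set_integrable lborel (cball (0::'a) \<rho>) (\<lambda>x. 1 :: real)" for \<rho>
    unfolding set_integrable_def using fin by simp
  define I where "I = (LINT x:cball 0 1|lborel. \<phi> (sgn x \<bullet> b))"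
  define V where "V = (LINT x:cball (0::'a) 1|lborel. (1::real))"
  define D where "D r = (LINT x:cball 0 1|lborel. \<phi> (x \<bullet> b)) - (LINT x:cball 0 r|lborel. \<phi> (x \<bullet> b))" for r
  have V0: "0 \<le> V"
    unfolding V_def set_lebesgue_integral_def by (intro integral_nonneg_AE) auto
  have I: "(LINT x:cball 0 r|lborel. \<phi> (sgn x \<bullet> b)) = r ^ DIM('a) * I" if "0 < r" for r
    unfolding I_def using that by (intro set_integral_cball_scale) (auto simp: sgn_scaleR)
  have V: "(LINT x:cball (0::'a) r|lborel. (1::real)) = r ^ DIM('a) * V" if "0 < r" for r
    unfolding V_def using that by (intro set_integral_cball_scale) auto
  \<comment> \<open>The shell has volume (1 - r^d) * V, which is of the order of 1 - r. After
    division by 1 - r only the modulus of continuity \<open>e\<close> has to become small.\<close>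
  have key: "\<bar>D r - (1 - r ^ DIM('a)) * I\<bar> \<le> e * ((1 - r ^ DIM('a)) * V)"
    if r: "0 < r" "r < 1" and e: "\<And>u v. u \<in> {-1..1} \<Longrightarrow> v \<in> {-1..1} \<Longrightarrow> dist u v \<le> 1 - r \<Longrightarrow> \<bar>\<phi> u - \<phi> v\<bar> \<le> e" for r e
  proof -
    let ?S = "cball (0::'a) 1 - cball 0 r"
    have sub: "cball (0::'a) r \<subseteq> cball 0 1" using r by auto
    have diff: "(LINT x:?S|lborel. g x) = (LINT x:cball 0 1|lborel. g x) - (LINT x:cball 0 r|lborel. g x)"
      and intS: "set_integrable lborel ?S g"
      if "set_integrable lborel (cball 0 1) g" for g :: "'a \<Rightarrow> real"
    proof -
      show S: "set_integrable lborel ?S g"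
        by (rule set_integrable_subset[OF that]) auto
      have r': "set_integrable lborel (cball 0 r) g"
        by (rule set_integrable_subset[OF that _ sub]) simp
      have "(LINT x:cball 0 r \<union> ?S|lborel. g x) = (LINT x:cball 0 r|lborel. g x) + (LINT x:?S|lborel. g x)"
        by (rule set_integral_Un[OF _ r' S]) auto
      moreover have "cball 0 r \<union> ?S = cball 0 1" using sub by auto
      ultimately show "(LINT x:?S|lborel. g x) = (LINT x:cball 0 1|lborel. g x) - (LINT x:cball 0 r|lborel. g x)"
        by simp
    qed
    have pw: "\<bar>\<phi> (x \<bullet> b) - \<phi> (sgn x \<bullet> b)\<bar> \<le> e" if "x \<in> ?S" for x
    proof (rule e)
      have x: "norm x \<le> 1" "r < norm x" using that by auto
      show "x \<bullet> b \<in> {-1..1}" using inner_le[of x] x by auto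
      show "sgn x \<bullet> b \<in> {-1..1}" using inner_le[of "sgn x"] norm_sgn[of x] by (auto split: if_splits)
      have "x - sgn x = (1 - inverse (norm x)) *\<^sub>R x"
        by (simp add: sgn_div_norm algebra_simps)
      then have "norm (x - sgn x) = \<bar>(1 - inverse (norm x)) * norm x\<bar>" by (simp add: abs_mult)
      also have "(1 - inverse (norm x)) * norm x = norm x - 1"
        using x r by (cases "x = 0") (auto simp: algebra_simps)
      finally have "norm (x - sgn x) \<le> 1 - r" using x by simp
      with inner_le[of "x - sgn x"] show "dist (x \<bullet> b) (sgn x \<bullet> b) \<le> 1 - r"
        by (simp add: dist_real_def inner_diff_left)
    qed
    have "D r - (1 - r ^ DIM('a)) * I = (LINT x:?S|lborel. \<phi> (x \<bullet> b)) - (LINT x:?S|lborel. \<phi> (sgn x \<bullet> b))"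
      using r by (simp add: diff int1 int2 D_def I algebra_simps)
    also have "\<dots> = (LINT x:?S|lborel. \<phi> (x \<bullet> b) - \<phi> (sgn x \<bullet> b))"
      by (intro set_integral_diff(2)[symmetric] intS int1 int2) simp
    also have "\<bar>\<dots>\<bar> \<le> (LINT x:?S|lborel. \<bar>\<phi> (x \<bullet> b) - \<phi> (sgn x \<bullet> b)\<bar>)"
      unfolding set_lebesgue_integral_def
      by (rule order_trans[OF integral_abs_bound]) (simp add: abs_mult)
    also have "\<dots> \<le> (LINT x:?S|lborel. e * 1)"
    proof (rule set_integral_mono)
      show "set_integrable lborel ?S (\<lambda>x. \<bar>\<phi> (x \<bullet> b) - \<phi> (sgn x \<bullet> b)\<bar>)"
        by (rule set_integrable_abs, rule set_integral_diff(1); rule intS) (use int1 int2 in auto)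
      show "set_integrable lborel ?S (\<lambda>x. e * 1)"
        by (rule set_integrable_mult_right) (rule intS, rule int3)
      show "\<bar>\<phi> (x \<bullet> b) - \<phi> (sgn x \<bullet> b)\<bar> \<le> e * 1" if "x \<in> ?S" for x
        using pw[OF that] by simp
    qed
    also have "\<dots> = e * ((1 - r ^ DIM('a)) * V)"
      unfolding set_integral_mult_right using r diff[OF int3[of 1]] V[of r]
      by (simp add: V_def[symmetric] left_diff_distrib)
    finally show ?thesis .
  qed
  have quot: "(\<lambda>n. (1 - R n ^ DIM('a)) / (1 - R n)) \<longlonglongrightarrow> DIM('a)"
  proof -
    have "((\<lambda>r::real. r ^ DIM('a)) has_real_derivative real DIM('a)) (at 1)"
      by (auto intro!: derivative_eq_intros)
    then have "((\<lambda>r::real. (r ^ DIM('a) - 1) / (r - 1)) \<longlongrightarrow> real DIM('a)) (at 1)"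
      by (simp add: has_field_derivative_iff)
    moreover have "filterlim R (at 1) sequentially"
      using R(1,3) by (auto simp: filterlim_at intro!: always_eventually) (metis less_irrefl)
    ultimately have "(\<lambda>n. (R n ^ DIM('a) - 1) / (R n - 1)) \<longlonglongrightarrow> real DIM('a)"
      by (rule filterlim_compose)
    moreover have "(R n ^ DIM('a) - 1) / (R n - 1) = (1 - R n ^ DIM('a)) / (1 - R n)" for n
      using minus_divide_divide[of "1 - R n ^ DIM('a)" "1 - R n"] by simp
    ultimately show ?thesis by simp
  qed
  have "(\<lambda>n. D (R n) / (1 - R n) - (1 - R n ^ DIM('a)) / (1 - R n) * I) \<longlonglongrightarrow> 0"
  proof (rule LIMSEQ_I)
    fix \<epsilon> :: real assume \<epsilon>: "0 < \<epsilon>"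
    \<comment> \<open>Bernoulli's inequality will bound the shell volume divided by 1 - R n by
      \<open>DIM('a) * V\<close>. The added 1 keeps the denominator positive for every V \<ge> 0 and
      makes the final estimate strict.\<close>
    define e where "e = \<epsilon> / (DIM('a) * V + 1)"
    have pos: "0 < DIM('a) * V + 1" using V0 by (simp add: add_nonneg_pos)
    then have e: "0 < e" using \<epsilon> by (simp add: e_def)
    have uc: "uniformly_continuous_on {-1..1} \<phi>"
      using \<phi> by (intro compact_uniformly_continuous) (auto intro: continuous_on_subset)
    obtain \<delta> where \<delta>: "0 < \<delta>"
      "\<forall>u\<in>{-1..1}. \<forall>v\<in>{-1..1}. dist v u < \<delta> \<longrightarrow> dist (\<phi> v) (\<phi> u) < e"
      using uc[unfolded uniformly_continuous_on_def, rule_format, OF e] by blast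
    obtain N where "\<forall>n\<ge>N. norm (R n - 1) < \<delta>"
      using LIMSEQ_D[OF R(1) \<delta>(1)] by blast
    then have N: "1 - R n < \<delta>" if "N \<le> n" for n
      using that R(3)[of n] by auto
    have "norm (D (R n) / (1 - R n) - (1 - R n ^ DIM('a)) / (1 - R n) * I - 0) < \<epsilon>" if "N \<le> n" for n
    proof -
      have "\<bar>D (R n) - (1 - R n ^ DIM('a)) * I\<bar> \<le> e * ((1 - R n ^ DIM('a)) * V)"
      proof (rule key[OF R(2,3)])
        fix u v :: real assume "u \<in> {-1..1}" "v \<in> {-1..1}" "dist u v \<le> 1 - R n"
        with \<delta>(2)[rule_format, of v u] N[OF that] show "\<bar>\<phi> u - \<phi> v\<bar> \<le> e" by (simp add: dist_real_def)
      qed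
      also have "\<dots> \<le> e * ((DIM('a) * (1 - R n)) * V)"
      proof (intro mult_left_mono mult_right_mono V0)
        show "1 - R n ^ DIM('a) \<le> DIM('a) * (1 - R n)"
          using Bernoulli_inequality[of "R n - 1" "DIM('a)"] R(2)[of n] by (simp add: algebra_simps)
      qed (use e in auto)
      finally have "\<bar>D (R n) - (1 - R n ^ DIM('a)) * I\<bar> / (1 - R n) \<le> e * (DIM('a) * V)"
        using R(3)[of n] by (simp add: divide_le_eq mult_ac)
      also have "\<dots> < e * (DIM('a) * V + 1)" using e by simp
      also have "\<dots> = \<epsilon>" using pos by (simp add: e_def)
      finally have "\<bar>(D (R n) - (1 - R n ^ DIM('a)) * I) / (1 - R n)\<bar> < \<epsilon>"
        using R(3)[of n] by simp
      then show ?thesis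
        by (simp only: diff_divide_distrib[of "D (R n)"] times_divide_eq_left real_norm_def diff_0_right)
    qed
    then show "\<exists>N. \<forall>n\<ge>N. norm (D (R n) / (1 - R n) - (1 - R n ^ DIM('a)) / (1 - R n) * I - 0) < \<epsilon>"
      by blast
  qed
  from tendsto_add[OF this tendsto_mult[OF quot tendsto_const[of I]]] show ?thesis
    by (simp add: D_def I_def)
qed

section \<open>The marginal law of the uniform distribution on the sphere\<close>

text \<open>Since d times the volume of the unit ball is the area of its boundary sphere, half the
  slicing constant is the ratio of the areas of the unit spheres in dimensions d - 1 and d. This is
  the factor that the comparison of slices and shells produces.\<close>

lemma slicing_const_eq_unit_ball_vol:
  assumes "2 \<le> d"
  shows "slicing_const d * (d * unit_ball_vol d) = 2 * ((d - 1) * unit_ball_vol (d - 1))"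
proof -
  have 1: "real d * unit_ball_vol d = 2 * pi powr (d / 2) / Gamma (d / 2)"
    if "1 \<le> d" for d :: nat
  proof -
    have "Gamma (real d / 2 + 1) = d / 2 * Gamma (d / 2)"
      using that by (intro Gamma_plus1) (auto simp: nonpos_Ints_def)
    then have "unit_ball_vol d = pi powr (d / 2) / (d / 2 * Gamma (d / 2))"
      unfolding unit_ball_vol_def by (simp only:)
    then show ?thesis using that by simp
  qed
  have 2: "pi powr (d / 2) = sqrt pi * pi powr ((d - 1) / 2)"
    using assms by (simp add: powr_half_sqrt[symmetric] powr_add[symmetric] of_nat_diff diff_divide_distrib)
  have "Gamma (real d / 2) \<noteq> 0" "Gamma ((real d - 1) / 2) \<noteq> 0"
    using assms Gamma_real_pos[of "real d / 2"] Gamma_real_pos[of "(real d - 1) / 2"] by force+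
  then show ?thesis
    using 1[of d] 1[of "d - 1"] assms
    by (simp add: of_nat_diff slicing_const_def 2)
qed

lemma integral_uniform_sphere_inner_Basis:
  fixes b :: "'a::euclidean_space" and \<phi> :: "real \<Rightarrow> real"
  assumes b: "b \<in> Basis" and \<phi>: "continuous_on UNIV \<phi>" and dim: "3 \<le> DIM('a)"
  shows "(LINT x|uniform_sphere. \<phi> (x \<bullet> b)) =
    slicing_const DIM('a) / 2 * (LINT u:{-1..1}|lborel. sqrt (1 - u\<^sup>2) ^ (DIM('a) - 3) * \<phi> u)"
proof -
  have [measurable]: "\<phi> \<in> borel_measurable borel"
    using \<phi> by (rule borel_measurable_continuous_onI)
  let ?d = "DIM('a)"
  define W where "W = unit_ball_vol (real (?d - 1))"
  define I where "I = (LINT x:cball 0 1|lborel. \<phi> (sgn x \<bullet> b))"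
  define J where "J = (LINT u:{-1..1}|lborel. sqrt (1 - u\<^sup>2) ^ (?d - 3) * \<phi> u)"
  \<comment> \<open>The radii 1 - 1/(n+2) start at 1/2; with 1 - 1/(n+1) the first one would be 0,
    which the shell and slice formulas exclude.\<close>
  define R where "R n = 1 + - inverse (real (Suc (Suc n)))" for n
  have R: "R \<longlonglongrightarrow> 1" "\<And>n. 0 < R n" "\<And>n. R n < 1"
  proof -
    show "R \<longlonglongrightarrow> 1" unfolding R_def by (rule LIMSEQ_Suc[OF LIMSEQ_inverse_real_of_nat_add_minus])
  qed (auto simp: R_def field_simps)
  have q_int: "integrable lborel (\<lambda>u. sqrt (max 0 (r\<^sup>2 - u\<^sup>2)) ^ (?d - 1) * \<phi> u)" for r
  proof -
    have "integrable lborel (\<lambda>u. indicator {-\<bar>r\<bar>..\<bar>r\<bar>} u *\<^sub>R (sqrt (max 0 (r\<^sup>2 - u\<^sup>2)) ^ (?d - 1) * \<phi> u))"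
      using \<phi> by (intro borel_integrable_compact continuous_intros) (auto intro: continuous_on_subset)
    also have "(\<lambda>u. indicator {-\<bar>r\<bar>..\<bar>r\<bar>} u *\<^sub>R (sqrt (max 0 (r\<^sup>2 - u\<^sup>2)) ^ (?d - 1) * \<phi> u)) =
        (\<lambda>u. sqrt (max 0 (r\<^sup>2 - u\<^sup>2)) ^ (?d - 1) * \<phi> u)"
    proof
      fix u
      show "indicator {-\<bar>r\<bar>..\<bar>r\<bar>} u *\<^sub>R (sqrt (max 0 (r\<^sup>2 - u\<^sup>2)) ^ (?d - 1) * \<phi> u) =
        sqrt (max 0 (r\<^sup>2 - u\<^sup>2)) ^ (?d - 1) * \<phi> u"
      proof (cases "u \<in> {-\<bar>r\<bar>..\<bar>r\<bar>}")
        case False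
        then have "\<bar>r\<bar> \<le> \<bar>u\<bar>" by auto
        then have "r\<^sup>2 \<le> u\<^sup>2" by (simp add: abs_le_square_iff)
        then show ?thesis using dim by simp
      qed simp
    qed
    finally show ?thesis .
  qed
  have "((LINT x:cball 0 1|lborel. \<phi> (x \<bullet> b)) - (LINT x:cball 0 (R n)|lborel. \<phi> (x \<bullet> b))) / (1 - R n) =
    W * (LINT u|lborel. (sqrt (max 0 (1 - u\<^sup>2)) ^ (?d - 1) - sqrt (max 0 ((R n)\<^sup>2 - u\<^sup>2)) ^ (?d - 1)) / (1 - R n) * \<phi> u)" for n
  proof -
    have eq: "(LINT x:cball 0 r|lborel. \<phi> (x \<bullet> b)) = W * (LINT u|lborel. sqrt (max 0 (r\<^sup>2 - u\<^sup>2)) ^ (?d - 1) * \<phi> u)"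
      if "0 < r" for r
      using integral_cball_inner_Basis[OF b that] dim by (simp add: W_def mult.assoc)
    have "(LINT x:cball 0 1|lborel. \<phi> (x \<bullet> b)) - (LINT x:cball 0 (R n)|lborel. \<phi> (x \<bullet> b)) =
      W * (LINT u|lborel. sqrt (max 0 (1\<^sup>2 - u\<^sup>2)) ^ (?d - 1) * \<phi> u - sqrt (max 0 ((R n)\<^sup>2 - u\<^sup>2)) ^ (?d - 1) * \<phi> u)"
      using R(2)[of n] by (subst Bochner_Integration.integral_diff[OF q_int q_int]) (simp add: eq right_diff_distrib)
    moreover have "(LINT u|lborel. (sqrt (max 0 (1 - u\<^sup>2)) ^ (?d - 1) - sqrt (max 0 ((R n)\<^sup>2 - u\<^sup>2)) ^ (?d - 1)) / (1 - R n) * \<phi> u) =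
      (LINT u|lborel. sqrt (max 0 (1\<^sup>2 - u\<^sup>2)) ^ (?d - 1) * \<phi> u - sqrt (max 0 ((R n)\<^sup>2 - u\<^sup>2)) ^ (?d - 1) * \<phi> u) / (1 - R n)"
      by (subst integral_divide_zero[symmetric]) (simp add: left_diff_distrib diff_divide_distrib)
    ultimately show ?thesis by (simp only: times_divide_eq_right)
  qed
  with shell_difference_quotient_tendsto[OF b \<phi> R]
  have 1: "(\<lambda>n. W * (LINT u|lborel. (sqrt (max 0 (1 - u\<^sup>2)) ^ (?d - 1) - sqrt (max 0 ((R n)\<^sup>2 - u\<^sup>2)) ^ (?d - 1)) / (1 - R n) * \<phi> u))
    \<longlonglongrightarrow> ?d * I"
    by (simp add: I_def)
  have 2: "(\<lambda>n. W * (LINT u|lborel. (sqrt (max 0 (1 - u\<^sup>2)) ^ (?d - 1) - sqrt (max 0 ((R n)\<^sup>2 - u\<^sup>2)) ^ (?d - 1)) / (1 - R n) * \<phi> u))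
    \<longlonglongrightarrow> W * (LINT u:{-1..1}|lborel. real (?d - 1) * sqrt (1 - u\<^sup>2) ^ (?d - 1 - 2) * \<phi> u)"
    using dim R(2) by (intro tendsto_mult tendsto_const slice_difference_quotient_tendsto \<phi> R) (auto intro: less_imp_le)
  have "?d * I = W * (real (?d - 1) * J)"
    using LIMSEQ_unique[OF 1 2] by (simp add: J_def mult.assoc numeral_3_eq_3 flip: set_integral_mult_right)
  moreover have "(LINT x|uniform_sphere. \<phi> (x \<bullet> b)) = I / unit_ball_vol ?d"
  proof -
    let ?V = "unit_ball_vol (real ?d)"
    have V: "0 < ?V" by simp
    have [measurable]: "cball (0::'a) 1 \<in> sets borel" "ball (0::'a) 1 \<in> sets borel"
      by (auto intro: borel_closed)
    have "uniform_measure lborel (ball (0::'a) 1) = density lborel (\<lambda>x. ennreal (indicator (ball 0 1) x / ?V))"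
      unfolding uniform_measure_def using V
      by (auto simp: emeasure_ball indicator_def divide_ennreal[symmetric] intro!: density_cong)
    then have "(LINT x|uniform_sphere. \<phi> (x \<bullet> b)) =
        (LINT x|density lborel (\<lambda>x. ennreal (indicator (ball (0::'a) 1) x / ?V)). \<phi> (sgn x \<bullet> b))"
      unfolding uniform_sphere_def by (subst integral_distr) auto
    also have "\<dots> = (LINT x|lborel. indicator (ball 0 1) x / ?V * \<phi> (sgn x \<bullet> b))"
      by (subst integral_density) auto
    \<comment> \<open>The sphere measure comes from the open ball and the shell computation from
      closed balls; they differ by the sphere, a null set.\<close>
    also have "\<dots> = (LINT x|lborel. indicator (cball 0 1) x / ?V * \<phi> (sgn x \<bullet> b))"
    proof (rule integral_cong_AE)
      have "AE x in lebesgue. x \<notin> sphere (0::'a) 1"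
        using negligible_sphere[of "0::'a" 1] by (intro AE_not_in) (simp add: negligible_iff_null_sets)
      then have "AE x in lborel. x \<notin> sphere (0::'a) 1"
        by (simp add: AE_completion_iff)
      then show "AE x in lborel. indicator (ball 0 1) x / ?V * \<phi> (sgn x \<bullet> b) = indicator (cball 0 1) x / ?V * \<phi> (sgn x \<bullet> b)"
        by eventually_elim (auto simp: indicator_def)
    qed auto
    also have "\<dots> = I / ?V"
      by (simp add: I_def set_lebesgue_integral_def flip: integral_divide_zero)
    finally show ?thesis .
  qed
  moreover have "slicing_const ?d * (?d * unit_ball_vol ?d) = 2 * (real (?d - 1) * W)"
    using slicing_const_eq_unit_ball_vol[of ?d] dim by (simp add: W_def of_nat_diff)
  ultimately have "real ?d * (2 * I) = slicing_const ?d * (?d * unit_ball_vol ?d) * J"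
    and *: "(LINT x|uniform_sphere. \<phi> (x \<bullet> b)) = I / unit_ball_vol ?d"
    by simp_all
  then have "real ?d * (2 * I) = real ?d * (slicing_const ?d * J * unit_ball_vol ?d)"
    by (simp only: mult_ac)
  then have "2 * I = slicing_const ?d * J * unit_ball_vol ?d"
    by simp
  moreover have "unit_ball_vol (real ?d) \<noteq> 0"
    using unit_ball_vol_pos[of "real ?d"] by linarith
  ultimately show ?thesis
    by (simp add: * divide_eq_eq J_def)
qed

section \<open>The mean square error\<close>

lemma lebesgue_on_integral_eq_lborel:
  fixes g :: "real \<Rightarrow> real"
  assumes [measurable]: "g \<in> borel_measurable borel"
  shows "(LINT t|lebesgue_on {a..b}. g t) = (LINT t:{a..b}|lborel. g t)"
  unfolding set_lebesgue_integral_def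
  by (subst integral_restrict_space) (auto simp: integral_completion)

lemma continuous_on_slicing_density:
  "continuous_on UNIV (slicing_density d)"
  unfolding slicing_density_def by (intro continuous_intros)

text \<open>The integrand f(s \<bar>u\<bar>) is even, so [-1, 1] contributes twice the integral over
  [0, 1]. This cancels the factor 1/2 in front of the slicing constant.\<close>

lemma integral_uniform_sphere_eq_slicing_op:
  fixes b :: "'a::euclidean_space" and f :: "real \<Rightarrow> real"
  assumes b: "b \<in> Basis" and f: "continuous_on UNIV f" and dim: "3 \<le> DIM('a)" and s: "0 \<le> s"
  shows "(LINT x|uniform_sphere. f \<bar>x \<bullet> (s *\<^sub>R b)\<bar>) = slicing_op DIM('a) f s"
proof -
  define \<phi> where "\<phi> u = f (s * \<bar>u\<bar>)" for u
  have \<phi>: "continuous_on UNIV \<phi>"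
    unfolding \<phi>_def by (intro continuous_on_compose2[OF f] continuous_intros) auto
  define g where "g u = sqrt (1 - u\<^sup>2) ^ (DIM('a) - 3) * \<phi> u" for u
  have g: "continuous_on UNIV g"
    unfolding g_def by (intro continuous_intros \<phi>)
  have int: "set_integrable lborel {\<alpha>..\<beta>} g" for \<alpha> \<beta>
    by (rule borel_integrable_atLeastAtMost') (rule continuous_on_subset[OF g], simp)
  have "(LINT u:{-1..1}|lborel. g u) = (LINT u:{-1..0}|lborel. g u) + (LINT u:{0..1}|lborel. g u)"
  proof -
    have "(LINT u:{-1..0} \<union> {0..1}|lborel. g u) = (LINT u:{-1..0}|lborel. g u) + (LINT u:{0..1}|lborel. g u)"
      by (rule set_integral_Un_AE[OF _ _ _ int int])
         (use AE_lborel_singleton[of "0::real"] in \<open>auto elim!: eventually_mono\<close>)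
    moreover have "{-1..0} \<union> {0..1} = {-1..1::real}" by auto
    ultimately show ?thesis by simp
  qed
  also have "(LINT u:{-1..0}|lborel. g u) = (LINT u:{0..1}|lborel. g u)"
  proof -
    have "{x. - x \<in> {-1..0}} = {0..1::real}" by auto
    moreover have "g (- u) = g u" for u by (simp add: g_def \<phi>_def)
    ultimately show ?thesis by (subst set_integral_reflect) simp
  qed
  finally have even: "(LINT u:{-1..1}|lborel. g u) = 2 * (LINT u:{0..1}|lborel. g u)"
    by simp
  have "(LINT x|uniform_sphere. f \<bar>x \<bullet> (s *\<^sub>R b)\<bar>) = (LINT x|uniform_sphere. \<phi> (x \<bullet> b))"
    using s by (simp add: \<phi>_def abs_mult)
  also have "\<dots> = slicing_const DIM('a) * (LINT u:{0..1}|lborel. g u)"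
    using integral_uniform_sphere_inner_Basis[OF b \<phi> dim] even by (simp add: g_def)
  also have "\<dots> = (LINT u:{0..1}|lborel. f (u * s) * slicing_density DIM('a) u)"
    by (subst set_integral_mult_right[symmetric])
       (auto simp: g_def \<phi>_def slicing_density_def mult_ac intro!: set_lebesgue_integral_cong)
  also have "\<dots> = slicing_op DIM('a) f s"
    unfolding slicing_op_def
    by (intro lebesgue_on_integral_eq_lborel[symmetric] borel_measurable_continuous_onI
        continuous_intros continuous_on_compose2[OF f] continuous_on_slicing_density) auto
  finally show ?thesis .
qed

section \<open>Mean square deviation of an average of independent variables\<close>

text \<open>The decomposition into variance and squared bias. After centring, independence
  annihilates the off-diagonal products, so P diagonal terms meet the factor 1/P^2. The almost sure
  bound supplies the integrability of all products.\<close>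

lemma (in prob_space) expectation_square_mean_deviation:
  fixes X :: "nat \<Rightarrow> 'a \<Rightarrow> real"
  assumes indep: "indep_vars (\<lambda>_. borel) X {1..P}" and P: "1 \<le> P"
    and bd: "\<And>p. p \<in> {1..P} \<Longrightarrow> AE \<omega> in M. \<bar>X p \<omega>\<bar> \<le> C"
    and mean: "\<And>p. p \<in> {1..P} \<Longrightarrow> expectation (X p) = m"
    and second: "\<And>p. p \<in> {1..P} \<Longrightarrow> expectation (\<lambda>\<omega>. (X p \<omega>)\<^sup>2) = v"
  shows "expectation (\<lambda>\<omega>. (1 / real P * (\<Sum>p=1..P. X p \<omega>) - c)\<^sup>2) = (v - m\<^sup>2) / real P + (m - c)\<^sup>2"
proof -
  have rv [measurable]: "random_variable borel (X p)" if "p \<in> {1..P}" for p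
    using indep that by (auto simp: indep_vars_def)
  have int: "integrable M (X p)" if p: "p \<in> {1..P}" for p
    by (rule integrable_const_bound[of _ C]) (use bd[OF p] rv[OF p] in auto)
  have int2: "integrable M (\<lambda>\<omega>. X p \<omega> * X q \<omega>)" if p: "p \<in> {1..P}" and q: "q \<in> {1..P}" for p q
  proof (rule integrable_const_bound[of _ "C * C"])
    show "AE \<omega> in M. norm (X p \<omega> * X q \<omega>) \<le> C * C"
      using bd[OF p] bd[OF q]
      by eventually_elim (auto simp: abs_mult intro!: mult_mono)
  qed (use rv[OF p] rv[OF q] in measurable)
  define Y where "Y p \<omega> = X p \<omega> - m" for p \<omega>
  have Yint: "integrable M (Y p)" if "p \<in> {1..P}" for p
    unfolding Y_def using int[OF that] by simp
  have EY: "expectation (Y p) = 0" if "p \<in> {1..P}" for p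
    unfolding Y_def using int[OF that] mean[OF that] by (simp add: prob_space)
  have YY: "Y p \<omega> * Y q \<omega> = X p \<omega> * X q \<omega> - m * X p \<omega> - m * X q \<omega> + m * m" for p q \<omega>
    by (simp add: Y_def algebra_simps)
  have Yint2: "integrable M (\<lambda>\<omega>. Y p \<omega> * Y q \<omega>)" if "p \<in> {1..P}" "q \<in> {1..P}" for p q
    unfolding YY using int int2 that by simp
  have EYY: "expectation (\<lambda>\<omega>. Y p \<omega> * Y q \<omega>) = (if p = q then v - m\<^sup>2 else 0)"
    if p: "p \<in> {1..P}" and q: "q \<in> {1..P}" for p q
  proof (cases "p = q")
    case True
    then show ?thesis
      using p int[OF p] int2[OF p p] mean[OF p] second[OF p]
      by (simp add: YY prob_space power2_eq_square)
  next
    case False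
    have "indep_vars (\<lambda>_. borel) X {p, q}"
      by (rule indep_vars_subset[OF indep]) (use p q in auto)
    then have "indep_vars (\<lambda>_. borel) Y {p, q}"
      unfolding Y_def by (rule indep_vars_compose2) simp
    then have "expectation (\<lambda>\<omega>. \<Prod>i\<in>{p, q}. Y i \<omega>) = (\<Prod>i\<in>{p, q}. expectation (Y i))"
      using Yint p q by (intro indep_vars_lebesgue_integral) auto
    then show ?thesis using False EY[OF p] by simp
  qed
  have "(1 / real P * (\<Sum>p=1..P. X p \<omega>) - c)\<^sup>2 =
      1 / (real P)\<^sup>2 * (\<Sum>p=1..P. \<Sum>q=1..P. Y p \<omega> * Y q \<omega>) + 2 * (m - c) / real P * (\<Sum>p=1..P. Y p \<omega>) + (m - c)\<^sup>2" for \<omega>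
  proof -
    have "1 / real P * (\<Sum>p=1..P. X p \<omega>) - c = 1 / real P * (\<Sum>p=1..P. Y p \<omega>) + (m - c)"
      using P by (simp add: Y_def sum_subtractf field_simps)
    moreover have "(1 / real P * S + k)\<^sup>2 = 1 / (real P)\<^sup>2 * (S * S) + 2 * k / real P * S + k\<^sup>2" for S k
      by (simp add: power2_eq_square algebra_simps)
    ultimately show ?thesis
      by (simp only: sum_product[symmetric])
  qed
  note square = this
  define A where "A \<omega> = (\<Sum>p=1..P. \<Sum>q=1..P. Y p \<omega> * Y q \<omega>)" for \<omega>
  define B where "B \<omega> = (\<Sum>p=1..P. Y p \<omega>)" for \<omega>
  have A: "integrable M A" "expectation A = (\<Sum>p=1..P. \<Sum>q=1..P. expectation (\<lambda>\<omega>. Y p \<omega> * Y q \<omega>))"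
    unfolding A_def
    by (intro trans[OF Bochner_Integration.integral_sum] sum.cong refl
        Bochner_Integration.integrable_sum Yint2; assumption)+
  have B: "integrable M B" "expectation B = (\<Sum>p=1..P. expectation (Y p))"
    unfolding B_def using Yint
    by (auto simp: Bochner_Integration.integral_sum intro!: Bochner_Integration.integrable_sum)
  have "expectation (\<lambda>\<omega>. (1 / real P * (\<Sum>p=1..P. X p \<omega>) - c)\<^sup>2) =
      1 / (real P)\<^sup>2 * (\<Sum>p=1..P. \<Sum>q=1..P. expectation (\<lambda>\<omega>. Y p \<omega> * Y q \<omega>)) +
      2 * (m - c) / real P * (\<Sum>p=1..P. expectation (Y p)) + (m - c)\<^sup>2"
    unfolding square A_def[symmetric] B_def[symmetric] A(2)[symmetric] B(2)[symmetric]
    using A(1) B(1) by (simp add: prob_space)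
  also have "\<dots> = (v - m\<^sup>2) / real P + (m - c)\<^sup>2"
    using P by (simp add: EYY EY power2_eq_square)
  finally show ?thesis .
qed

section \<open>A Sobolev inequality\<close>

lemma prob_space_lebesgue_on_unit_interval: "prob_space (lebesgue_on {0..1::real})"
  by standard (simp add: emeasure_restrict_space space_restrict_space)

text \<open>Nonnegativity of the variance. On the unit interval, a probability space under Lebesgue
  measure, it takes the place of the Cauchy-Schwarz inequality.\<close>

lemma (in prob_space) expectation_square_le:
  fixes u :: "'a \<Rightarrow> real"
  assumes "integrable M u" "integrable M (\<lambda>x. (u x)\<^sup>2)"
  shows "(expectation u)\<^sup>2 \<le> expectation (\<lambda>x. (u x)\<^sup>2)"
  using variance_eq[OF assms] variance_positive[of u] by simp

lemma
  assumes h: "in_L2 h"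
  shows in_L2_integrable_square: "integrable (lebesgue_on {0..1}) (\<lambda>x. (h x)\<^sup>2)"
    and L2_norm_square_eq: "(L2_norm h)\<^sup>2 = ennreal (LINT x|lebesgue_on {0..1}. (h x)\<^sup>2)"
proof -
  interpret prob_space "lebesgue_on {0..1::real}" by (rule prob_space_lebesgue_on_unit_interval)
  have [measurable]: "h \<in> borel_measurable (lebesgue_on {0..1})"
    using h by (simp add: in_L2_def)
  have eq: "(L2_norm h)\<^sup>2 = (\<integral>\<^sup>+x. ennreal ((h x)\<^sup>2) \<partial>lebesgue_on {0..1})"
    by (simp add: Lp_norm_2_square)
  have "L2_norm h < \<infinity>" using h by (simp add: in_L2_def)
  then have "(L2_norm h)\<^sup>2 < \<infinity>" by (simp add: power_less_top_ennreal)
  then show int: "integrable (lebesgue_on {0..1}) (\<lambda>x. (h x)\<^sup>2)"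
    unfolding eq by (intro integrableI_nonneg) auto
  then show "(L2_norm h)\<^sup>2 = ennreal (LINT x|lebesgue_on {0..1}. (h x)\<^sup>2)"
    unfolding eq by (intro nn_integral_eq_integral) auto
qed

section \<open>Mollified point evaluations\<close>

text \<open>An antiderivative of the ramp \<open>max 0 t\<close>. Test functions have to be only
  once continuously differentiable, so piecewise quadratic splines built from this function can
  serve as smooth steps.\<close>

definition ramp_square :: "real \<Rightarrow> real" where
  "ramp_square t = (max 0 t)\<^sup>2 / 2"

lemma ramp_square_has_derivative: "(ramp_square has_real_derivative max 0 t) (at t)"
proof (cases t "0 :: real" rule: linorder_cases)
  case less
  have "((\<lambda>_. 0 :: real) has_real_derivative 0) (at t)" by simp
  then have "(ramp_square has_real_derivative 0) (at t)"
    by (rule has_field_derivative_transform_within_open[where S = "{..<0}"])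
       (use less in \<open>auto simp: ramp_square_def\<close>)
  with less show ?thesis by simp
next
  case equal
  have "((\<lambda>u::real. max 0 u / 2) \<longlongrightarrow> max 0 0 / 2) (at 0)"
    by (intro tendsto_intros) auto
  then have "((\<lambda>u. (ramp_square u - ramp_square 0) / (u - 0)) \<longlongrightarrow> 0) (at 0)"
    by (rule Lim_transform_eventually[OF tendsto_eq_rhs])
       (auto simp: eventually_at_filter ramp_square_def max_def power2_eq_square)
  then show ?thesis using equal by (simp add: has_field_derivative_iff)
next
  case greater
  have "((\<lambda>u::real. u\<^sup>2 / 2) has_real_derivative t) (at t)"
    by (auto intro!: derivative_eq_intros)
  then have "(ramp_square has_real_derivative t) (at t)"
    by (rule has_field_derivative_transform_within_open[where S = "{0<..}"])
       (use greater in \<open>auto simp: ramp_square_def\<close>)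
  with greater show ?thesis by simp
qed

text \<open>
  The antiderivative of the tent with support \<open>[0, 2]\<close> and integral 1. A difference of two rescaled
  copies is a test function whose derivative approximates a difference of two point evaluations.
\<close>

definition smooth_step :: "real \<Rightarrow> real" where
  "smooth_step t = ramp_square t - 2 * ramp_square (t - 1) + ramp_square (t - 2)"

definition tent_kernel :: "real \<Rightarrow> real" where
  "tent_kernel t = max 0 t - 2 * max 0 (t - 1) + max 0 (t - 2)"

lemma tent_kernel_nonneg: "0 \<le> tent_kernel t"
  and tent_kernel_eq_0: "t \<notin> {0..2} \<Longrightarrow> tent_kernel t = 0"
  by (auto simp: tent_kernel_def max_def)

lemma smooth_step_eq_0: "t \<le> 0 \<Longrightarrow> smooth_step t = 0"
  by (simp add: smooth_step_def ramp_square_def)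

lemma smooth_step_eq_1: "2 \<le> t \<Longrightarrow> smooth_step t = 1"
  by (simp add: smooth_step_def ramp_square_def max_def power2_eq_square field_simps)

lemma smooth_step_has_derivative: "(smooth_step has_real_derivative tent_kernel t) (at t)"
proof -
  have "((\<lambda>t. ramp_square (t - c)) has_real_derivative max 0 (t - c)) (at t)" for c
  proof -
    have "((\<lambda>t. t - c) has_real_derivative 1) (at t)"
      by (auto intro!: derivative_eq_intros)
    from DERIV_chain2[OF ramp_square_has_derivative this] show ?thesis by simp
  qed
  from this[of 0] this[of 1] this[of 2] show ?thesis
    unfolding smooth_step_def[abs_def] tent_kernel_def
    by (auto intro!: derivative_eq_intros)
qed

lemma smooth_step_mono: "s \<le> t \<Longrightarrow> smooth_step s \<le> smooth_step t"
  by (rule DERIV_nonneg_imp_nondecreasing) (use smooth_step_has_derivative tent_kernel_nonneg in blast)+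

lemma smooth_step_bounds: "0 \<le> smooth_step t" "smooth_step t \<le> 1"
  using smooth_step_mono[of "min 0 t" t] smooth_step_eq_0[of "min 0 t"]
    smooth_step_mono[of t "max 2 t"] smooth_step_eq_1[of "max 2 t"] by simp_all

lemma smooth_step_affine_has_derivative:
  "((\<lambda>t. smooth_step ((t - x) / e)) has_real_derivative tent_kernel ((t - x) / e) / e) (at t)"
proof -
  have "((\<lambda>t. (t - x) / e) has_real_derivative 1 / e) (at t)"
    by (rule DERIV_cdivide) (auto intro!: derivative_eq_intros)
  from DERIV_chain2[OF smooth_step_has_derivative this] show ?thesis by simp
qed

lemma continuous_on_tent_kernel: "continuous_on S (\<lambda>t. tent_kernel ((t - x) / e) / e)"
  unfolding tent_kernel_def divide_inverse by (intro continuous_intros)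

text \<open>The rescaled tent is nonnegative, has integral 1 and lives on [x, x + 2e], to the right
  of x. Integrating against it is a one-sided local average, which continuity of \<open>G\<close>
  keeps close to \<open>G x\<close>.\<close>

lemma tent_kernel_mollify:
  assumes G: "continuous_on {0..1} G" and x: "0 < x" "x < 1" and \<eta>: "0 < \<eta>"
  shows "\<forall>\<^sub>F e in at_right 0.
    \<bar>(LINT t|lebesgue_on {0..1}. G t * (tent_kernel ((t - x) / e) / e)) - G x\<bar> \<le> \<eta>"
proof -
  obtain \<delta> where \<delta>: "0 < \<delta>" "\<forall>t\<in>{0..1}. dist t x < \<delta> \<longrightarrow> dist (G t) (G x) < \<eta>"
    using G x \<eta> unfolding continuous_on_iff by (metis atLeastAtMost_iff less_imp_le)
  \<comment> \<open>The bound \<delta> / 2 puts the support within distance \<delta> of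
    \<open>x\<close>; the bound (1 - x) / 2 keeps it inside [0, 1], so that no mass of the tent is
    lost.\<close>
  have "\<bar>(LINT t|lebesgue_on {0..1}. G t * (tent_kernel ((t - x) / e) / e)) - G x\<bar> \<le> \<eta>"
    if e: "0 < e" "e < min (\<delta> / 2) ((1 - x) / 2)" for e
  proof -
    define K where "K t = tent_kernel ((t - x) / e) / e" for t
    have K0: "0 \<le> K t" for t using e by (simp add: K_def tent_kernel_nonneg)
    have Kc: "continuous_on {0..1} K" unfolding K_def by (rule continuous_on_tent_kernel)
    note Kint = continuous_imp_integrable_real[OF Kc]
    have GKint: "integrable (lebesgue_on {0..1}) (\<lambda>t. G t * K t)"
      by (intro continuous_imp_integrable_real continuous_on_mult G Kc)
    have "(K has_integral smooth_step ((1 - x) / e) - smooth_step ((0 - x) / e)) {0..1}"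
      unfolding K_def
      by (rule fundamental_theorem_of_calculus)
         (auto intro!: has_field_derivative_at_within smooth_step_affine_has_derivative
           simp flip: has_real_derivative_iff_has_vector_derivative)
    moreover have "smooth_step ((1 - x) / e) = 1"
      by (rule smooth_step_eq_1) (use e in \<open>simp add: pos_le_divide_eq\<close>)
    moreover have "smooth_step ((0 - x) / e) = 0"
      by (rule smooth_step_eq_0) (use e x in \<open>simp add: divide_le_0_iff\<close>)
    ultimately have "(K has_integral 1) {0..1}" by simp
    then have K1: "(LINT t|lebesgue_on {0..1}. K t) = 1"
      by (simp add: lebesgue_integral_eq_integral[OF Kint] integral_unique)
    have pw: "\<bar>(G t - G x) * K t\<bar> \<le> \<eta> * K t" if t: "t \<in> {0..1}" for t
    proof (cases "(t - x) / e \<in> {0..2}")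
      case True
      then have "\<bar>t - x\<bar> < \<delta>" using e by (auto simp: pos_le_divide_eq pos_divide_le_eq)
      then have "\<bar>G t - G x\<bar> \<le> \<eta>" using \<delta>(2) t by (force simp: dist_real_def)
      then show ?thesis using K0[of t] by (simp add: abs_mult mult_right_mono)
    next
      case False
      then show ?thesis by (simp add: K_def tent_kernel_eq_0)
    qed
    have "(LINT t|lebesgue_on {0..1}. G t * K t) - G x = (LINT t|lebesgue_on {0..1}. (G t - G x) * K t)"
      using GKint Kint K1 by (simp add: left_diff_distrib)
    also have "\<bar>\<dots>\<bar> \<le> (LINT t|lebesgue_on {0..1}. \<bar>(G t - G x) * K t\<bar>)"
      by (rule integral_abs_bound)
    also have "\<dots> \<le> (LINT t|lebesgue_on {0..1}. \<eta> * K t)"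
      using pw by (intro integral_mono integrable_abs integrable_mult_right Kint
          continuous_imp_integrable_real continuous_intros G Kc) (auto simp: space_restrict_space)
    finally show ?thesis using K1 by (simp add: K_def)
  qed
  moreover have "0 < min (\<delta> / 2) ((1 - x) / 2)" using \<delta>(1) x by simp
  ultimately show ?thesis
    unfolding eventually_at_right_field by blast
qed

text \<open>Tested with a smoothed indicator of [x, y], the weak derivative identity has nearly
  \<open>G x - G y\<close> on the left. On the right stands the integral of \<open>h\<close> against
  a function bounded by 1, which the L^2 norm of \<open>h\<close> controls independently of the
  smoothing width.\<close>

lemma weak_deriv_L2_diff_le:
  assumes G: "continuous_on {0..1} G" and h: "weak_deriv_L2 G h"
    and xy: "0 < x" "x < y" "y < 1"
  shows "(G x - G y)\<^sup>2 \<le> (LINT t|lebesgue_on {0..1}. (h t)\<^sup>2)"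
proof -
  interpret prob_space "lebesgue_on {0..1::real}" by (rule prob_space_lebesgue_on_unit_interval)
  have hL2: "in_L2 h" using h by (simp add: weak_deriv_L2_def)
  have [measurable]: "h \<in> borel_measurable (lebesgue_on {0..1})" using hL2 by (simp add: in_L2_def)
  note hint = in_L2_integrable_square[OF hL2]
  define N where "N = (LINT t|lebesgue_on {0..1}. (h t)\<^sup>2)"
  have N0: "0 \<le> N" unfolding N_def by (intro integral_nonneg_AE) simp
  have "\<bar>G x - G y\<bar> \<le> sqrt N + \<eta>" if \<eta>: "0 < \<eta>" for \<eta>
  proof -
    have "\<forall>\<^sub>F e in at_right 0. \<bar>(LINT t|lebesgue_on {0..1}. G t * (tent_kernel ((t - x) / e) / e)) - G x\<bar> \<le> \<eta> / 2 \<and>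
      \<bar>(LINT t|lebesgue_on {0..1}. G t * (tent_kernel ((t - y) / e) / e)) - G y\<bar> \<le> \<eta> / 2 \<and> 0 < e \<and> e < (1 - y) / 4"
      using xy \<eta> by (intro eventually_conj tent_kernel_mollify G eventually_at_right_less eventually_at_right_field[THEN iffD2]) (auto intro!: exI[of _ "(1 - y) / 4"])
    then obtain e where ex: "\<bar>(LINT t|lebesgue_on {0..1}. G t * (tent_kernel ((t - x) / e) / e)) - G x\<bar> \<le> \<eta> / 2"
      and ey: "\<bar>(LINT t|lebesgue_on {0..1}. G t * (tent_kernel ((t - y) / e) / e)) - G y\<bar> \<le> \<eta> / 2"
      and e: "0 < e" "e < (1 - y) / 4"
      by (auto dest!: eventually_happens simp: trivial_limit_at_right_real)
    \<comment> \<open>Both steps have the same width and height, so they cancel to the right of y +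
      2e. The choice e < (1 - y) / 4 keeps this point below 1, hence the support is compact in the
      open interval.\<close>
    define \<phi> where "\<phi> t = smooth_step ((t - x) / e) - smooth_step ((t - y) / e)" for t
    have d\<phi>: "(\<phi> has_real_derivative (tent_kernel ((t - x) / e) / e - tent_kernel ((t - y) / e) / e)) (at t)" for t
      unfolding \<phi>_def[abs_def] by (intro DERIV_diff smooth_step_affine_has_derivative)
    have deriv: "deriv \<phi> = (\<lambda>t. tent_kernel ((t - x) / e) / e - tent_kernel ((t - y) / e) / e)"
      using d\<phi> by (intro ext DERIV_imp_deriv)
    have supp: "\<phi> t = 0" if "t \<notin> {x..y + 2 * e}" for t
    proof (cases "t < x")
      case True
      then show ?thesis using e xy by (simp add: \<phi>_def smooth_step_eq_0 divide_le_0_iff)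
    next
      case False
      then have "y + 2 * e < t" using that by auto
      then show ?thesis using e xy by (simp add: \<phi>_def smooth_step_eq_1 pos_le_divide_eq)
    qed
    have test: "test_fun \<phi>"
      unfolding test_fun_def
    proof (intro conjI allI exI)
      show "\<phi> differentiable at t" for t using d\<phi> by (auto simp: real_differentiable_def)
      show "continuous_on UNIV (deriv \<phi>)"
        unfolding deriv by (intro continuous_on_diff continuous_on_tent_kernel)
      show "0 < x" by fact
      show "y + 2 * e < 1" using e xy by (simp add: field_simps)
      show "t \<notin> {x..y + 2 * e} \<longrightarrow> \<phi> t = 0" for t using supp by blast
    qed
    have \<phi>1: "\<bar>\<phi> t\<bar> \<le> 1" for t
      using smooth_step_bounds[of "(t - x) / e"] smooth_step_bounds[of "(t - y) / e"] by (simp add: \<phi>_def)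
    have [measurable]: "\<phi> \<in> borel_measurable borel"
      using d\<phi> by (intro borel_measurable_continuous_onI continuous_at_imp_continuous_on) (auto intro: DERIV_isCont)
    have [measurable]: "\<phi> \<in> borel_measurable (lebesgue_on {0..1})"
      by (intro measurable_restrict_space1 measurable_completion) simp
    have le: "(h t * \<phi> t)\<^sup>2 \<le> (h t)\<^sup>2" for t
      using mult_left_mono[of "(\<phi> t)\<^sup>2" 1 "(h t)\<^sup>2"] \<phi>1[of t] by (simp add: power_mult_distrib abs_square_le_1)
    have int2: "integrable (lebesgue_on {0..1}) (\<lambda>t. (h t * \<phi> t)\<^sup>2)"
      by (rule Bochner_Integration.integrable_bound[OF hint]) (use le in auto)
    have int1: "integrable (lebesgue_on {0..1}) (\<lambda>t. h t * \<phi> t)"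
      by (rule square_integrable_imp_integrable[OF _ int2]) measurable
    have "(LINT t|lebesgue_on {0..1}. h t * \<phi> t)\<^sup>2 \<le> (LINT t|lebesgue_on {0..1}. (h t * \<phi> t)\<^sup>2)"
      by (rule expectation_square_le[OF int1 int2])
    also have "\<dots> \<le> N"
      unfolding N_def by (intro integral_mono int2 hint le)
    finally have "\<bar>LINT t|lebesgue_on {0..1}. h t * \<phi> t\<bar> \<le> sqrt N"
      by (rule real_le_rsqrt[of "\<bar>_\<bar>", simplified])
    moreover have "(LINT t|lebesgue_on {0..1}. G t * deriv \<phi> t) = - (LINT t|lebesgue_on {0..1}. h t * \<phi> t)"
      using h test by (simp add: weak_deriv_L2_def)
    moreover have "(LINT t|lebesgue_on {0..1}. G t * deriv \<phi> t) =
      (LINT t|lebesgue_on {0..1}. G t * (tent_kernel ((t - x) / e) / e)) -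
      (LINT t|lebesgue_on {0..1}. G t * (tent_kernel ((t - y) / e) / e))"
      unfolding deriv right_diff_distrib
      by (intro Bochner_Integration.integral_diff continuous_imp_integrable_real continuous_on_mult G continuous_on_tent_kernel)
    ultimately show ?thesis using ex ey by linarith
  qed
  then have "\<bar>G x - G y\<bar> \<le> sqrt N" by (rule field_le_epsilon)
  then have "\<bar>G x - G y\<bar>\<^sup>2 \<le> (sqrt N)\<^sup>2" by (intro power_mono) auto
  then show ?thesis using N0 by (simp add: N_def)
qed

text \<open>Comparing \<open>G x\<close> with \<open>G y\<close> and integrating over all
  \<open>y\<close> in the unit interval, which has mass 1, replaces the unknown value at
  \<open>y\<close> by the L^2 norm. Outside H^1 the right-hand side is infinite.\<close>

lemma square_le_H1_norm_interior:
  assumes G: "continuous_on {0..1} G" and x: "0 < x" "x < 1"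
  shows "ennreal ((G x)\<^sup>2) \<le> 2 * (H1_norm G)\<^sup>2"
proof (cases "in_H1 G")
  case True
  interpret prob_space "lebesgue_on {0..1::real}" by (rule prob_space_lebesgue_on_unit_interval)
  \<comment> \<open>The same choice as in the definition of \<open>H1_norm\<close>, so that
    \<open>N\<close> below is exactly the derivative part of the norm.\<close>
  define h where "h = (SOME g. weak_deriv_L2 G g)"
  from True have "\<exists>g. weak_deriv_L2 G g"
    unfolding in_H1_def by (rule conjunct2)
  then have h: "weak_deriv_L2 G h"
    unfolding h_def by (rule someI_ex)
  have hL2: "in_L2 h" using h by (simp add: weak_deriv_L2_def)
  have GL2: "in_L2 G" using True by (simp add: in_H1_def)
  define N where "N = (LINT t|lebesgue_on {0..1}. (h t)\<^sup>2)"
  define Q where "Q = (LINT t|lebesgue_on {0..1}. (G t)\<^sup>2)"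
  have N0: "0 \<le> N" and Q0: "0 \<le> Q" unfolding N_def Q_def by (auto intro!: integral_nonneg_AE)
  have "H1_norm G = ennreal_root 2 (ennreal (Q + N))"
    using True L2_norm_square_eq[OF GL2] L2_norm_square_eq[OF hL2] N0 Q0
    by (simp add: H1_norm_def h_def[symmetric] Q_def N_def)
  then have H1: "(H1_norm G)\<^sup>2 = ennreal (Q + N)"
    using N0 Q0 by (simp add: ennreal_root_def ennreal_power powr_half_sqrt)
  have pw: "(G x)\<^sup>2 \<le> 2 * ((G y)\<^sup>2 + N)" if y: "0 < y" "y < 1" for y
  proof -
    have d: "(G x - G y)\<^sup>2 \<le> N"
      using weak_deriv_L2_diff_le[OF G h, of x y] weak_deriv_L2_diff_le[OF G h, of y x] x y N0
      by (cases x y rule: linorder_cases) (auto simp: N_def power2_commute)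
    \<comment> \<open>The right side minus the left side is exactly (G x - 2 * G y)^2.\<close>
    have "(G x)\<^sup>2 \<le> 2 * ((G y)\<^sup>2 + (G x - G y)\<^sup>2)"
      using zero_le_power2[of "G x - 2 * G y"] by (simp add: power2_eq_square algebra_simps)
    also have "\<dots> \<le> 2 * ((G y)\<^sup>2 + N)"
      using d by (intro mult_left_mono add_left_mono) auto
    finally show ?thesis .
  qed
  have int: "integrable (lebesgue_on {0..1}) (\<lambda>y. 2 * ((G y)\<^sup>2 + N))"
    using in_L2_integrable_square[OF GL2] by simp
  have "(LINT y|lebesgue_on {0..1::real}. (G x)\<^sup>2) \<le> (LINT y|lebesgue_on {0..1}. 2 * ((G y)\<^sup>2 + N))"
  proof (rule integral_mono_AE)
    have "AE y in lebesgue. y \<notin> {0, 1::real}"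
      by (intro AE_not_in) (simp add: null_sets_completionI countable_imp_null_set_lborel)
    then have "AE y in lebesgue_on {0..1::real}. y \<notin> {0, 1}"
      by (subst AE_restrict_space_iff) auto
    moreover have "AE y in lebesgue_on {0..1::real}. y \<in> {0..1}"
      by (rule AE_I2) (simp add: space_restrict_space)
    ultimately show "AE y in lebesgue_on {0..1}. (G x)\<^sup>2 \<le> 2 * ((G y)\<^sup>2 + N)"
      by eventually_elim (rule pw; force simp: less_le)
  qed (use int in auto)
  also have "\<dots> = 2 * (Q + N)"
    using in_L2_integrable_square[OF GL2] by (simp add: Q_def measure_restrict_space)
  finally have "(G x)\<^sup>2 \<le> 2 * (Q + N)" by (simp add: measure_restrict_space)
  then have "ennreal ((G x)\<^sup>2) \<le> ennreal (2 * (Q + N))" by (rule ennreal_leI)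
  then show ?thesis using N0 Q0 by (simp add: H1 ennreal_mult)
next
  case False
  then show ?thesis by (simp add: H1_norm_def ennreal_mult_top)
qed

section \<open>The error bounds\<close>

text \<open>Test functions see only the open interval; the endpoints are reached by continuity of
  \<open>G\<close>, since the bound does not depend on the point.\<close>

lemma square_le_H1_norm:
  assumes G: "continuous_on {0..1} G" and x: "x \<in> {0..1}"
  shows "ennreal ((G x)\<^sup>2) \<le> 2 * (H1_norm G)\<^sup>2"
proof (cases "2 * (H1_norm G)\<^sup>2")
  case (real B)
  have "(G x)\<^sup>2 \<le> B"
  proof (rule continuous_le_on_closure[of "{0<..<1::real}" "\<lambda>x. (G x)\<^sup>2"])
    show "continuous_on (closure {0<..<1}) (\<lambda>x. (G x)\<^sup>2)" "x \<in> closure {0<..<1}"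
      using x by (auto intro!: continuous_intros G)
    show "(G y)\<^sup>2 \<le> B" if "y \<in> {0<..<1}" for y
      using square_le_H1_norm_interior[OF G, of y] that real by auto
  qed
  then show ?thesis by (simp add: real ennreal_leI)
qed simp

section \<open>Continuity and bounds of the slicing operator\<close>

lemma slicing_const_nonneg: "2 \<le> d \<Longrightarrow> 0 \<le> slicing_const d"
  unfolding slicing_const_def
  by (intro divide_nonneg_nonneg mult_nonneg_nonneg order_less_imp_le[OF Gamma_real_pos]) auto

text \<open>Continuity in \<open>s\<close> makes the bias \<open>F - slicing_op d f\<close>
  accessible to the pointwise Sobolev bound and gives measurability of the error.\<close>

lemma continuous_on_slicing_op:
  assumes f: "continuous_on UNIV f"
  shows "continuous_on S (slicing_op d f)"
proof -
  have cont: "continuous_on A (\<lambda>t. f (t * s) * slicing_density d t)" for A s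
    by (intro continuous_intros continuous_on_compose2[OF f]
        continuous_on_compose2[OF continuous_on_slicing_density]) auto
  have "slicing_op d f s = integral (cbox 0 1) (\<lambda>t. f (t * s) * slicing_density d t)" for s
    unfolding slicing_op_def cbox_interval
    by (intro lebesgue_integral_eq_integral continuous_imp_integrable_real cont) simp
  moreover have "continuous_on S (\<lambda>s. integral (cbox 0 1) (\<lambda>t. f (t * s) * slicing_density d t))"
    by (intro integral_continuous_on_param) (auto simp: split_beta
        intro!: continuous_intros continuous_on_compose2[OF f]
        continuous_on_compose2[OF continuous_on_slicing_density])
  ultimately show ?thesis by (simp cong: continuous_on_cong)
qed

text \<open>The density is at most its constant on [0, 1], and the substitution u = t s produces the
  factor 1/s. This is the origin of the weight 1/s in the constant C_w.\<close>

lemma slicing_op_square_le: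
  assumes f: "continuous_on UNIV f" and d: "2 \<le> d" and s: "0 < s" "s \<le> 1"
  shows "slicing_op d (\<lambda>t. (f t)\<^sup>2) s \<le> slicing_const d / s * (LINT t|lebesgue_on {0..1}. (f t)\<^sup>2)"
proof -
  have fs: "continuous_on A (\<lambda>t. f (t * s))" for A
    by (intro continuous_intros continuous_on_compose2[OF f]) auto
  have f2: "continuous_on A (\<lambda>t. (f t)\<^sup>2)" for A
    by (intro continuous_intros continuous_on_subset[OF f]) auto
  have meas [measurable]: "f \<in> borel_measurable borel"
    using f by (rule borel_measurable_continuous_onI)
  have "slicing_op d (\<lambda>t. (f t)\<^sup>2) s \<le> (LINT t|lebesgue_on {0..1}. slicing_const d * (f (t * s))\<^sup>2)"
    unfolding slicing_op_def
  proof (intro integral_mono)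
    show "integrable (lebesgue_on {0..1}) (\<lambda>t. (f (t * s))\<^sup>2 * slicing_density d t)"
      by (intro continuous_imp_integrable_real continuous_intros fs
          continuous_on_subset[OF continuous_on_slicing_density]) auto
    show "integrable (lebesgue_on {0..1}) (\<lambda>t. slicing_const d * (f (t * s))\<^sup>2)"
      by (intro continuous_imp_integrable_real continuous_intros fs)
    fix t :: real assume "t \<in> space (lebesgue_on {0..1})"
    then have t: "0 \<le> t" "t \<le> 1" by (auto simp: space_restrict_space)
    have "sqrt (1 - t\<^sup>2) ^ (d - 3) \<le> 1"
      using t by (intro power_le_one) (auto simp: power_le_one)
    then have "slicing_density d t \<le> slicing_const d"
      using slicing_const_nonneg[OF d] by (simp add: slicing_density_def mult_left_le)
    then show "(f (t * s))\<^sup>2 * slicing_density d t \<le> slicing_const d * (f (t * s))\<^sup>2"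
      by (simp add: mult.commute mult_right_mono)
  qed
  also have "\<dots> = slicing_const d * (LINT t:{0..1}|lborel. (f (t * s))\<^sup>2)"
    by (simp add: lebesgue_on_integral_eq_lborel)
  also have "(LINT t:{0..1}|lborel. (f (t * s))\<^sup>2) = 1 / s * (LINT u:{0..s}|lborel. (f u)\<^sup>2)"
  proof -
    have "(LINT u:{0..s}|lborel. (f u)\<^sup>2) = s * (LINT t|lborel. indicator {0..s} (0 + s * t) * (f (0 + s * t))\<^sup>2)"
      unfolding set_lebesgue_integral_def
      using s by (subst lborel_integral_real_affine[where c = s and t = 0]) auto
    also have "(\<lambda>t. indicator {0..s} (0 + s * t) * (f (0 + s * t))\<^sup>2) = (\<lambda>t. indicator {0..1} t * (f (t * s))\<^sup>2)"
      using s by (auto simp: indicator_def fun_eq_iff mult.commute zero_le_mult_iff mult_le_cancel_left1)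
    finally show ?thesis using s by (simp add: set_lebesgue_integral_def)
  qed
  also have "(LINT u:{0..s}|lborel. (f u)\<^sup>2) \<le> (LINT u:{0..1}|lborel. (f u)\<^sup>2)"
    unfolding set_lebesgue_integral_def
    using s borel_integrable_atLeastAtMost'[OF f2, unfolded set_integrable_def]
    by (intro integral_mono) (auto simp: indicator_def)
  also have "(LINT u:{0..1}|lborel. (f u)\<^sup>2) = (LINT t|lebesgue_on {0..1}. (f t)\<^sup>2)"
    by (simp add: lebesgue_on_integral_eq_lborel)
  finally show ?thesis
    using s slicing_const_nonneg[OF d] by (simp add: mult_left_mono divide_right_mono)
qed

text \<open>The error does not depend on the point of norm \<open>s\<close>, so a multiple of a
  basis vector may be chosen, for which the law of the inner product is known. That law, applied to
  \<open>f\<close> and to its square, gives the mean and the second moment; compactness of [0, s]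
  gives the almost sure bound.\<close>

lemma slicing_rmse_square_eq:
  fixes \<xi> :: "nat \<Rightarrow> 'w \<Rightarrow> real ^ 'n"
  assumes dim: "3 \<le> CARD('n)" and P: "1 \<le> P" and M: "prob_space M"
    and indep: "prob_space.indep_vars M (\<lambda>_. borel) \<xi> {1..P}"
    and unif: "\<And>p. p \<in> {1..P} \<Longrightarrow> distr M borel (\<xi> p) = uniform_sphere"
    and f: "continuous_on UNIV f" and s: "0 \<le> s"
  shows "(slicing_rmse M \<xi> P f F s)\<^sup>2 =
    (slicing_op CARD('n) (\<lambda>t. (f t)\<^sup>2) s - (slicing_op CARD('n) f s)\<^sup>2) / real P
      + (F s - slicing_op CARD('n) f s)\<^sup>2"
proof -
  interpret prob_space M by (rule M)
  obtain b :: "real ^ 'n" where b: "b \<in> Basis" using nonempty_Basis by blast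
  define x where "x = s *\<^sub>R b"
  have x: "norm x = s" using b s by (simp add: x_def norm_Basis)
  have meas [measurable]: "f \<in> borel_measurable borel"
    using f by (rule borel_measurable_continuous_onI)
  have f2: "continuous_on UNIV (\<lambda>t. (f t)\<^sup>2)" by (intro continuous_intros f)
  have rv [measurable]: "random_variable borel (\<xi> p)" if "p \<in> {1..P}" for p
    using indep that by (auto simp: indep_vars_def)
  have E: "expectation (\<lambda>\<omega>. g \<bar>\<xi> p \<omega> \<bullet> x\<bar>) = slicing_op CARD('n) g s"
    if p: "p \<in> {1..P}" and g: "continuous_on UNIV g" for p g
  proof -
    have [measurable]: "g \<in> borel_measurable borel"
      using g by (rule borel_measurable_continuous_onI)
    have "expectation (\<lambda>\<omega>. g \<bar>\<xi> p \<omega> \<bullet> x\<bar>) = (LINT y|distr M borel (\<xi> p). g \<bar>y \<bullet> x\<bar>)"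
      using rv[OF p] by (subst integral_distr) auto
    then show ?thesis
      using integral_uniform_sphere_eq_slicing_op[OF b g _ s] dim by (simp add: unif[OF p] x_def)
  qed
  have "compact (f ` {0..s})"
    using f by (intro compact_continuous_image) (auto intro: continuous_on_subset)
  then obtain C where C: "\<And>u. u \<in> {0..s} \<Longrightarrow> \<bar>f u\<bar> \<le> C"
    by (force dest!: compact_imp_bounded simp: bounded_iff)
  have "expectation (\<lambda>\<omega>. (1 / real P * (\<Sum>p=1..P. f \<bar>\<xi> p \<omega> \<bullet> x\<bar>) - F s)\<^sup>2) =
      (slicing_op CARD('n) (\<lambda>t. (f t)\<^sup>2) s - (slicing_op CARD('n) f s)\<^sup>2) / real P
        + (slicing_op CARD('n) f s - F s)\<^sup>2"
  proof (rule expectation_square_mean_deviation[OF _ P])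
    show "indep_vars (\<lambda>_. borel) (\<lambda>p \<omega>. f \<bar>\<xi> p \<omega> \<bullet> x\<bar>) {1..P}"
      by (rule indep_vars_compose2[OF indep]) measurable
    fix p assume p: "p \<in> {1..P}"
    have "AE y in distr M borel (\<xi> p). norm y = 1"
      unfolding unif[OF p] by (rule AE_uniform_sphere)
    then have "AE \<omega> in M. norm (\<xi> p \<omega>) = 1"
      by (rule AE_distrD[OF rv[OF p]])
    then show "AE \<omega> in M. \<bar>f \<bar>\<xi> p \<omega> \<bullet> x\<bar>\<bar> \<le> C"
    proof eventually_elim
      case (elim \<omega>)
      then show ?case using Cauchy_Schwarz_ineq2[of "\<xi> p \<omega>" x] by (intro C) (simp add: x)
    qed
  qed (use E[OF _ f] E[OF _ f2] in auto)
  then show ?thesis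
    using slicing_rmse_square(2)[OF M indep unif meas x] by (simp add: x power2_commute)
qed

text \<open>Read as an expectation over the sphere, the slicing operator is an average over values
  of the square on [0, s]. The total mass 1 of the density thus comes from the probability measure,
  with no evaluation of a Beta integral.\<close>

lemma slicing_op_square_le_bound:
  assumes dim: "3 \<le> CARD('n::finite)" and f: "continuous_on UNIV f" and s: "s \<in> {0..1}"
    and B: "\<And>u. u \<in> {0..1} \<Longrightarrow> (f u)\<^sup>2 \<le> B"
  shows "slicing_op CARD('n) (\<lambda>t. (f t)\<^sup>2) s \<le> B"
proof -
  interpret prob_space "uniform_sphere :: (real ^ 'n) measure" by (rule prob_space_uniform_sphere)
  obtain b :: "real ^ 'n" where b: "b \<in> Basis" using nonempty_Basis by blast
  have "(LINT x|uniform_sphere. (f \<bar>x \<bullet> (s *\<^sub>R b)\<bar>)\<^sup>2) \<le> (LINT x|(uniform_sphere :: (real ^ 'n) measure). B)"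
  proof (rule integral_mono_AE')
    show "AE x in uniform_sphere. 0 \<le> B"
      using B[of 0] by (auto intro: order_trans[OF zero_le_power2])
    show "AE x in uniform_sphere. (f \<bar>x \<bullet> (s *\<^sub>R b)\<bar>)\<^sup>2 \<le> B"
      using AE_uniform_sphere
    proof eventually_elim
      case (elim x)
      then have "\<bar>x \<bullet> (s *\<^sub>R b)\<bar> \<le> \<bar>s\<bar>"
        using Cauchy_Schwarz_ineq2[of x "s *\<^sub>R b"] b by (simp add: norm_Basis)
      then show ?case using s by (intro B) simp
    qed
  qed simp
  moreover have "(LINT x|uniform_sphere. (f \<bar>x \<bullet> (s *\<^sub>R b)\<bar>)\<^sup>2) = slicing_op CARD('n) (\<lambda>t. (f t)\<^sup>2) s"
    using integral_uniform_sphere_eq_slicing_op[OF b, of "\<lambda>t. (f t)\<^sup>2" s] f s dim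
    by (auto intro!: continuous_intros)
  ultimately show ?thesis by (simp add: prob_space[simplified])
qed

theorem corollary12:
  fixes d P K :: nat
    and F w :: "real \<Rightarrow> real"
    and a :: "nat \<Rightarrow> real"
    and M :: "'w measure"
    and \<xi> :: "nat \<Rightarrow> 'w \<Rightarrow> real ^ 'n"
  assumes "d = CARD('n)" and "d \<ge> 3" and "P \<ge> 1" and "K \<ge> 1"
    and "continuous_on {0..1} F"
    and "w \<in> borel_measurable (lebesgue_on {0..1})"
    and "AE s in lebesgue_on {0..1}. 0 < w s"
    and "Lp_norm 1 (\<lambda>s. 1 / s) w < \<infinity>"
    and "prob_space M"
    and "prob_space.indep_vars M (\<lambda>_. borel) \<xi> {1..P}"
    and "\<And>p. p \<in> {1..P} \<Longrightarrow> distr M borel (\<xi> p) = uniform_sphere"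
  shows
    "(Lp_norm 2 w (slicing_rmse M \<xi> P (cos_poly K a) F))\<^sup>2
       \<le> ennreal (slicing_const d) * Lp_norm 1 (\<lambda>s. 1 / s) w * ennreal (1 / real P)
            * (L2_norm (cos_poly K a))\<^sup>2
         + (Lp_norm 2 w (\<lambda>s. F s - slicing_op d (cos_poly K a) s))\<^sup>2
     \<and>
     (Linf_norm (slicing_rmse M \<xi> P (cos_poly K a) F))\<^sup>2
       \<le> ennreal (3 / real P) * (H1_norm (cos_poly K a))\<^sup>2
         + 2 * (H1_norm (\<lambda>s. F s - slicing_op d (cos_poly K a) s))\<^sup>2"
proof -
  note d = \<open>d = CARD('n)\<close> and d3 = \<open>d \<ge> 3\<close> and P = \<open>P \<ge> 1\<close>
  note w [measurable] = \<open>w \<in> borel_measurable (lebesgue_on {0..1})\<close>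
  let ?\<mu> = "lebesgue_on {0..1::real}"
  define f where "f = cos_poly K a"
  define G where "G s = F s - slicing_op d f s" for s
  define E where "E = slicing_rmse M \<xi> P f F"
  have f: "continuous_on A f" for A
  proof -
    have "continuous_on A (cos_system k)" for k
      unfolding cos_system_def[abs_def] by (cases "k = 0") (auto intro!: continuous_intros)
    then show ?thesis
      unfolding f_def cos_poly_def[abs_def] by (intro continuous_intros)
  qed
  have f2: "continuous_on A (\<lambda>t. (f t)\<^sup>2)" for A by (intro continuous_intros f)
  have G: "continuous_on {0..1} G"
    unfolding G_def by (intro continuous_intros continuous_on_slicing_op assms f)
  have Gm [measurable]: "G \<in> borel_measurable ?\<mu>"
    using G by (rule continuous_imp_measurable_on_sets_lebesgue) simp
  have sm [measurable]: "(\<lambda>s. s) \<in> borel_measurable ?\<mu>"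
    by (rule continuous_imp_measurable_on_sets_lebesgue) auto
  have E2: "(E s)\<^sup>2 = (slicing_op d (\<lambda>t. (f t)\<^sup>2) s - (slicing_op d f s)\<^sup>2) / real P + (G s)\<^sup>2"
    if "0 \<le> s" for s
    using slicing_rmse_square_eq[of P M \<xi> f s F] assms f that
    by (simp add: E_def G_def)
  have E0: "0 \<le> E s" if s0: "0 \<le> s" for s
  proof -
    obtain x :: "real ^ 'n" where "norm x = s" by (rule vector_choose_size[OF s0])
    moreover have "f \<in> borel_measurable borel" using f by (rule borel_measurable_continuous_onI)
    ultimately show ?thesis unfolding E_def by (intro slicing_rmse_square(1)) (use assms in auto)
  qed
  define Q where "Q = (LINT t|?\<mu>. (f t)\<^sup>2)"
  have Q0: "0 \<le> Q" unfolding Q_def by (intro integral_nonneg_AE) simp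
  have L2f: "(L2_norm f)\<^sup>2 = ennreal Q"
    unfolding Lp_norm_2_square Q_def
    by (simp, intro nn_integral_eq_integral continuous_imp_integrable_real f2) simp
  have c0: "0 \<le> slicing_const d" using d3 by (intro slicing_const_nonneg) simp
  have "(Lp_norm 2 w E)\<^sup>2 = (\<integral>\<^sup>+s. ennreal ((E s)\<^sup>2 * w s) \<partial>?\<mu>)"
    by (rule Lp_norm_2_square)
  also have "\<dots> \<le> (\<integral>\<^sup>+s. ennreal (slicing_const d * Q / real P) * ennreal (\<bar>w s\<bar> powr 1 * (1 / s)) +
      ennreal ((G s)\<^sup>2 * w s) \<partial>?\<mu>)"
  proof (rule nn_integral_mono_AE)
    \<comment> \<open>At s = 0 the expression \<open>1 / s\<close> has the default value 0 and
      \<open>slicing_op_square_le\<close> does not apply; the point is a null set.\<close>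
    have "AE s in lebesgue. s \<noteq> (0::real)"
      by (rule AE_completion) (rule AE_lborel_singleton)
    then have "AE s in ?\<mu>. s \<noteq> 0"
      by (subst AE_restrict_space_iff) auto
    moreover have "AE s in ?\<mu>. s \<in> {0..1}"
      by (rule AE_I2) (simp add: space_restrict_space)
    ultimately show "AE s in ?\<mu>. ennreal ((E s)\<^sup>2 * w s) \<le>
      ennreal (slicing_const d * Q / real P) * ennreal (\<bar>w s\<bar> powr 1 * (1 / s)) + ennreal ((G s)\<^sup>2 * w s)"
      using \<open>AE s in ?\<mu>. 0 < w s\<close>
    proof eventually_elim
      case (elim s)
      then have s: "0 < s" "s \<le> 1" and ws: "0 < w s" by auto
      have "slicing_op d (\<lambda>t. (f t)\<^sup>2) s - (slicing_op d f s)\<^sup>2 \<le> slicing_op d (\<lambda>t. (f t)\<^sup>2) s"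
        by simp
      also have "\<dots> \<le> slicing_const d / s * Q"
        unfolding Q_def using d3 s by (intro slicing_op_square_le f) auto
      finally have "(slicing_op d (\<lambda>t. (f t)\<^sup>2) s - (slicing_op d f s)\<^sup>2) / real P \<le> slicing_const d / s * Q / real P"
        by (rule divide_right_mono) simp
      then have "(E s)\<^sup>2 \<le> slicing_const d / s * Q / real P + (G s)\<^sup>2"
        using E2[of s] s by simp
      then have "(E s)\<^sup>2 * w s \<le> (slicing_const d / s * Q / real P + (G s)\<^sup>2) * w s"
        using ws by (intro mult_right_mono) auto
      also have "\<dots> = slicing_const d * Q / real P * (\<bar>w s\<bar> powr 1 * (1 / s)) + (G s)\<^sup>2 * w s"
        using ws by (simp add: distrib_right)
      finally have "ennreal ((E s)\<^sup>2 * w s) \<le> ennreal (\<dots>)"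
        by (rule ennreal_leI)
      also have "\<dots> = ennreal (slicing_const d * Q / real P) * ennreal (\<bar>w s\<bar> powr 1 * (1 / s)) + ennreal ((G s)\<^sup>2 * w s)"
        using ws s c0 Q0 by (simp add: ennreal_plus ennreal_mult[symmetric])
      finally show ?case .
    qed
  qed
  also have "\<dots> = ennreal (slicing_const d * Q / real P) * (\<integral>\<^sup>+s. ennreal (\<bar>w s\<bar> powr 1 * (1 / s)) \<partial>?\<mu>) +
      (\<integral>\<^sup>+s. ennreal ((G s)\<^sup>2 * w s) \<partial>?\<mu>)"
    by (subst nn_integral_add) (measurable, simp add: nn_integral_cmult)
  also have "(\<integral>\<^sup>+s. ennreal (\<bar>w s\<bar> powr 1 * (1 / s)) \<partial>?\<mu>) = Lp_norm 1 (\<lambda>s. 1 / s) w"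
  proof -
    have "ennreal_root 1 x = x" for x
      by (cases x) (auto simp: ennreal_root_def)
    then show ?thesis by (simp add: Lp_norm_def)
  qed
  also have "(\<integral>\<^sup>+s. ennreal ((G s)\<^sup>2 * w s) \<partial>?\<mu>) = (Lp_norm 2 w G)\<^sup>2"
    by (rule Lp_norm_2_square[symmetric])
  also have "ennreal (slicing_const d * Q / real P) * Lp_norm 1 (\<lambda>s. 1 / s) w =
      ennreal (slicing_const d) * Lp_norm 1 (\<lambda>s. 1 / s) w * ennreal (1 / real P) * (L2_norm f)\<^sup>2"
  proof -
    have "ennreal (slicing_const d * Q / real P) = ennreal (slicing_const d) * ennreal (1 / real P) * ennreal Q"
      using c0 Q0 by (simp add: ennreal_mult[symmetric])
    then show ?thesis by (simp add: L2f mult_ac)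
  qed
  finally have first: "(Lp_norm 2 w E)\<^sup>2 \<le> ennreal (slicing_const d) * Lp_norm 1 (\<lambda>s. 1 / s) w *
      ennreal (1 / real P) * (L2_norm f)\<^sup>2 + (Lp_norm 2 w G)\<^sup>2" .
  \<comment> \<open>An infinite right-hand side leaves nothing to prove; this includes the case that
    \<open>F\<close> lies outside H^1. Otherwise all terms are finite and the comparison takes place
    in the reals.\<close>
  have "(Linf_norm E)\<^sup>2 \<le> ennreal (3 / real P) * (H1_norm f)\<^sup>2 + 2 * (H1_norm G)\<^sup>2"
  proof (cases "ennreal (3 / real P) * (H1_norm f)\<^sup>2 + 2 * (H1_norm G)\<^sup>2")
    case (real R)
    have "ennreal ((E s)\<^sup>2) \<le> ennreal R" if s: "s \<in> {0..1}" for s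
    proof -
      \<comment> \<open>Finiteness is read off from the finite right-hand side, because the factor
        3/P is positive, and not derived from the form of the cosine polynomial.\<close>
      have "(H1_norm f)\<^sup>2 \<noteq> \<infinity>"
        using real P by (auto simp: ennreal_mult_top)
      then obtain B where B: "0 \<le> B" "(H1_norm f)\<^sup>2 = ennreal B"
        by (cases "(H1_norm f)\<^sup>2") auto
      have "slicing_op d (\<lambda>t. (f t)\<^sup>2) s \<le> 2 * B"
        unfolding d
      proof (rule slicing_op_square_le_bound)
        show "(f u)\<^sup>2 \<le> 2 * B" if "u \<in> {0..1}" for u
        proof -
          have "2 * ennreal B = ennreal (2 * B)" using B(1) by (simp add: ennreal_mult)
          then show ?thesis using square_le_H1_norm[OF f that] B by simp
        qed
      qed (use s d d3 f in auto)
      \<comment> \<open>The Sobolev inequality gives 2 * B, and subtracting a square can only help;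
        the factor is enlarged to the 3 of the stated bound.\<close>
      then have "slicing_op d (\<lambda>t. (f t)\<^sup>2) s - (slicing_op d f s)\<^sup>2 \<le> 3 * B"
        using B(1) zero_le_power2[of "slicing_op d f s"] by linarith
      then have "(slicing_op d (\<lambda>t. (f t)\<^sup>2) s - (slicing_op d f s)\<^sup>2) / real P \<le> 3 * B / real P"
        by (rule divide_right_mono) simp
      then have "(E s)\<^sup>2 \<le> 3 / real P * B + (G s)\<^sup>2"
        using E2[of s] s by simp
      then have "ennreal ((E s)\<^sup>2) \<le> ennreal (3 / real P * B + (G s)\<^sup>2)"
        by (rule ennreal_leI)
      also have "\<dots> = ennreal (3 / real P) * (H1_norm f)\<^sup>2 + ennreal ((G s)\<^sup>2)"
        using B by (simp add: ennreal_plus ennreal_mult[symmetric])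
      also have "\<dots> \<le> ennreal (3 / real P) * (H1_norm f)\<^sup>2 + 2 * (H1_norm G)\<^sup>2"
        by (intro add_left_mono square_le_H1_norm[OF G s])
      finally show ?thesis by (simp add: real)
    qed
    then have le: "E s \<le> sqrt R" if "s \<in> {0..1}" for s
      using that real(1) by (intro real_le_rsqrt) simp
    \<comment> \<open>The bound on \<open>esssup\<close> requires a measurable function. Since
      \<open>E\<close> involves the choice of a point for each \<open>s\<close>, measurability is
      taken from the closed formula \<open>E2\<close>, the square root of which is continuous in
      \<open>s\<close>.\<close>
    have "E \<in> borel_measurable ?\<mu>"
    proof -
      have "(\<lambda>s. sqrt ((slicing_op d (\<lambda>t. (f t)\<^sup>2) s - (slicing_op d f s)\<^sup>2) / real P + (G s)\<^sup>2)) \<in> borel_measurable ?\<mu>"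
        by (intro continuous_imp_measurable_on_sets_lebesgue continuous_intros continuous_on_slicing_op f f2 G)
           (use P in auto)
      also have "?this \<longleftrightarrow> E \<in> borel_measurable ?\<mu>"
        by (rule measurable_cong) (auto simp: space_restrict_space E2[symmetric] E0)
      finally show ?thesis .
    qed
    then have "Linf_norm E \<le> ennreal (sqrt R)"
      unfolding Linf_norm_def
      by (intro esssup_I) (auto intro!: AE_I2 ennreal_leI simp: space_restrict_space le E0)
    then have "(Linf_norm E)\<^sup>2 \<le> (ennreal (sqrt R))\<^sup>2"
      by (intro power_mono) auto
    then show ?thesis using real by (simp add: ennreal_power)
  next
    case top
    then show ?thesis by (simp only: top_greatest)
  qed
  with first show ?thesis
    by (simp add: E_def G_def[abs_def] f_def)
qed

end
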